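(* Let $\mathcal{A}$ be an abelian category and $\mathcal{P}$ be a precovering and preenveloping (full additive) subcategory such that the stable category $\underline{\mathcal{A}}=\mathcal{A}/\mathcal{P}$ has split idempotents. The assignment $\mathcal{X}\rightsquigarrow\underline{\mathcal{X}}$ defines: (1) A bijection between the preenveloping weakly $\mathcal{P}$-resolving subcategories $\mathcal{X}$ of $\mathcal{A}$ closed under direct summands and the reflective subcategories $\underline{\mathcal{X}}$ of $\underline{\mathcal{A}}$ such that $\Omega(\underline{\mathcal{X}})\subseteq\underline{\mathcal{X}}$. (2) A bijection between the precovering weakly $\mathcal{P}$-coresolving subcategories $\mathcal{X}$ of $\mathcal{A}$ closed under direct summands and the coreflective subcategories $\underline{\mathcal{X}}$ of $\underline{\mathcal{A}}$ such that $\Sigma(\underline{\mathcal{X}})\subseteq\underline{\mathcal{X}}$.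
   Context: All subcategories are full and closed under isomorphisms. A subcategory is coreflective (reflective) if its inclusion has a right (left) adjoint. The stable category $\underline{\mathcal{A}}=\mathcal{A}/\mathcal{P}$ has the objects of $\mathcal{A}$ (written $\underline{A}$), and $\underline{\mathcal{A}}(A,B)$ is the quotient of $\mathcal{A}(A,B)$ by the subgroup of morphisms factoring through an object of $\mathcal{P}$. For a subcategory $\mathcal{X}\supseteq\mathcal{P}$, $\underline{\mathcal{X}}=\mathcal{X}/\mathcal{P}$ is the full subcategory of $\underline{\mathcal{A}}$ on the objects of $\mathcal{X}$. For a class $\mathcal{X}$, a morphism $f$ is an $\mathcal{X}$-epimorphism (resp. $\mathcal{X}$-monomorphism) if $\mathcal{A}(X,f)$ (resp. $\mathcal{A}(f,X)$) is surjective for every $X\in\mathcal{X}$. An $\mathcal{X}$-precover of $A$ is an $\mathcal{X}$-epimorphism $X\to A$ with $X\in\mathcal{X}$; an $\mathcal{X}$-preenvelope of $A$ is an $\mathcal{X}$-monomorphism $A\to X$ with $X\in\mathcal{X}$. $\mathcal{X}$ is precovering (preenveloping) if every object has an $\mathcal{X}$-precover ($\mathcal{X}$-preenvelope). The loop functor $\Omega:\underline{\mathcal{A}}\to\underline{\mathcal{A}}$ sends $\underline{A}$ to the kernel of a $\mathcal{P}$-precover $P_A\to A$, and the suspension functor $\Sigma:\underline{\mathcal{A}}\to\underline{\mathcal{A}}$ sends $\underline{A}$ to the cokernel of a $\mathcal{P}$-preenvelope $A\to P^A$ (both well defined up to isomorphism in $\underline{\mathcal{A}}$). A full additive subcategory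 $\mathcal{X}$ of $\mathcal{A}$ is weakly $\mathcal{P}$-resolving if $\mathcal{P}\subseteq\mathcal{X}$, every object of $\mathcal{X}$ has a $\mathcal{P}$-precover, and the kernel of every $\mathcal{P}$-epimorphism between objects of $\mathcal{X}$ is in $\mathcal{X}$. Dually, $\mathcal{X}$ is weakly $\mathcal{P}$-coresolving if $\mathcal{P}\subseteq\mathcal{X}$, every object of $\mathcal{X}$ has a $\mathcal{P}$-preenvelope, and the cokernel of every $\mathcal{P}$-monomorphism between objects of $\mathcal{X}$ is in $\mathcal{X}$. Split idempotents: each idempotent $e:A\to A$ factors as $e=ip$ with $pi=1$. *)

theory Defs
  imports "HOL-Algebra.Coset"
begin

text \<open>
  Every category in this development carries an abelian group structure on each of its
  hom-sets. The group of morphisms \<open>A \<rightarrow> B\<close> is a multiplicatively written group of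
  HOL-Algebra: its \<open>\<otimes>\<close> is the addition of morphisms and its \<open>\<one>\<close> is the zero morphism.
  Values of \<open>HomGrp\<close> at arguments outside \<open>Obj\<close> are irrelevant. Composition is written in
  the usual order, \<open>g \<cdot> f\<close> being \<open>g\<close> after \<open>f\<close>.
\<close>

record ('o, 'm) cat =
  Obj :: "'o set"
  HomGrp :: "'o \<Rightarrow> 'o \<Rightarrow> 'm monoid"
  Ident :: "'o \<Rightarrow> 'm"
  Comp :: "'m \<Rightarrow> 'm \<Rightarrow> 'm"  (infixl "\<cdot>\<index>" 70)

abbreviation Hom :: "('o, 'm) cat \<Rightarrow> 'o \<Rightarrow> 'o \<Rightarrow> 'm set" where
  "Hom C A B \<equiv> carrier (HomGrp C A B)"

abbreviation zero_mor :: "('o, 'm) cat \<Rightarrow> 'o \<Rightarrow> 'o \<Rightarrow> 'm" where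
  "zero_mor C A B \<equiv> \<one>\<^bsub>HomGrp C A B\<^esub>"


section \<open>Abelian categories\<close>

locale preadditive_category =
  fixes C :: "('o, 'm) cat" (structure)
  assumes hom_disjoint:
      "\<lbrakk>A \<in> Obj C; B \<in> Obj C; A' \<in> Obj C; B' \<in> Obj C; f \<in> Hom C A B; f \<in> Hom C A' B'\<rbrakk>
        \<Longrightarrow> A = A' \<and> B = B'"
    and ident_closed: "A \<in> Obj C \<Longrightarrow> Ident C A \<in> Hom C A A"
    and comp_closed:
      "\<lbrakk>A \<in> Obj C; B \<in> Obj C; D \<in> Obj C; f \<in> Hom C A B; g \<in> Hom C B D\<rbrakk> \<Longrightarrow> g \<cdot> f \<in> Hom C A D"
    and comp_ident: "\<lbrakk>A \<in> Obj C; B \<in> Obj C; f \<in> Hom C A B\<rbrakk> \<Longrightarrow> f \<cdot> Ident C A = f"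
    and ident_comp: "\<lbrakk>A \<in> Obj C; B \<in> Obj C; f \<in> Hom C A B\<rbrakk> \<Longrightarrow> Ident C B \<cdot> f = f"
    and comp_assoc:
      "\<lbrakk>A \<in> Obj C; B \<in> Obj C; D \<in> Obj C; E \<in> Obj C;
        f \<in> Hom C A B; g \<in> Hom C B D; h \<in> Hom C D E\<rbrakk> \<Longrightarrow> h \<cdot> (g \<cdot> f) = (h \<cdot> g) \<cdot> f"
    and hom_comm_group: "\<lbrakk>A \<in> Obj C; B \<in> Obj C\<rbrakk> \<Longrightarrow> comm_group (HomGrp C A B)"
    and comp_additive_right:
      "\<lbrakk>A \<in> Obj C; B \<in> Obj C; D \<in> Obj C; g \<in> Hom C B D\<rbrakk>
        \<Longrightarrow> (\<lambda>f. g \<cdot> f) \<in> hom (HomGrp C A B) (HomGrp C A D)"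
    and comp_additive_left:
      "\<lbrakk>A \<in> Obj C; B \<in> Obj C; D \<in> Obj C; f \<in> Hom C A B\<rbrakk>
        \<Longrightarrow> (\<lambda>g. g \<cdot> f) \<in> hom (HomGrp C B D) (HomGrp C A D)"

definition isomorphic :: "('o, 'm) cat \<Rightarrow> 'o \<Rightarrow> 'o \<Rightarrow> bool" where
  "isomorphic C A B \<longleftrightarrow>
    (\<exists>f \<in> Hom C A B. \<exists>g \<in> Hom C B A. g \<cdot>\<^bsub>C\<^esub> f = Ident C A \<and> f \<cdot>\<^bsub>C\<^esub> g = Ident C B)"

definition is_zero_object :: "('o, 'm) cat \<Rightarrow> 'o \<Rightarrow> bool" where
  "is_zero_object C Z \<longleftrightarrow>
    Z \<in> Obj C \<and> (\<forall>A \<in> Obj C. (\<exists>!f. f \<in> Hom C Z A) \<and> (\<exists>!f. f \<in> Hom C A Z))"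

definition is_biproduct :: "('o, 'm) cat \<Rightarrow> 'o \<Rightarrow> 'o \<Rightarrow> 'o \<Rightarrow> bool" where
  "is_biproduct C A B S \<longleftrightarrow>
    A \<in> Obj C \<and> B \<in> Obj C \<and> S \<in> Obj C \<and>
    (\<exists>i \<in> Hom C A S. \<exists>j \<in> Hom C B S. \<exists>p \<in> Hom C S A. \<exists>q \<in> Hom C S B.
      p \<cdot>\<^bsub>C\<^esub> i = Ident C A \<and> q \<cdot>\<^bsub>C\<^esub> j = Ident C B \<and>
      q \<cdot>\<^bsub>C\<^esub> i = zero_mor C A B \<and> p \<cdot>\<^bsub>C\<^esub> j = zero_mor C B A \<and>
      (i \<cdot>\<^bsub>C\<^esub> p) \<otimes>\<^bsub>HomGrp C S S\<^esub> (j \<cdot>\<^bsub>C\<^esub> q) = Ident C S)"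

locale additive_category = preadditive_category +
  assumes zero_object_exists: "\<exists>Z. is_zero_object C Z"
    and biproduct_exists: "\<lbrakk>A \<in> Obj C; B \<in> Obj C\<rbrakk> \<Longrightarrow> \<exists>S. is_biproduct C A B S"

definition is_mono :: "('o, 'm) cat \<Rightarrow> 'o \<Rightarrow> 'o \<Rightarrow> 'm \<Rightarrow> bool" where
  "is_mono C A B f \<longleftrightarrow>
    A \<in> Obj C \<and> B \<in> Obj C \<and> f \<in> Hom C A B \<and>
    (\<forall>T \<in> Obj C. \<forall>u \<in> Hom C T A. \<forall>v \<in> Hom C T A. f \<cdot>\<^bsub>C\<^esub> u = f \<cdot>\<^bsub>C\<^esub> v \<longrightarrow> u = v)"

definition is_epi :: "('o, 'm) cat \<Rightarrow> 'o \<Rightarrow> 'o \<Rightarrow> 'm \<Rightarrow> bool" where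
  "is_epi C A B f \<longleftrightarrow>
    A \<in> Obj C \<and> B \<in> Obj C \<and> f \<in> Hom C A B \<and>
    (\<forall>T \<in> Obj C. \<forall>u \<in> Hom C B T. \<forall>v \<in> Hom C B T. u \<cdot>\<^bsub>C\<^esub> f = v \<cdot>\<^bsub>C\<^esub> f \<longrightarrow> u = v)"

text \<open>\<open>is_kernel C A B f K k\<close>: the morphism \<open>k : K \<rightarrow> A\<close> is a kernel of \<open>f : A \<rightarrow> B\<close>.\<close>

definition is_kernel :: "('o, 'm) cat \<Rightarrow> 'o \<Rightarrow> 'o \<Rightarrow> 'm \<Rightarrow> 'o \<Rightarrow> 'm \<Rightarrow> bool" where
  "is_kernel C A B f K k \<longleftrightarrow>
    A \<in> Obj C \<and> B \<in> Obj C \<and> K \<in> Obj C \<and> f \<in> Hom C A B \<and> k \<in> Hom C K A \<and>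
    f \<cdot>\<^bsub>C\<^esub> k = zero_mor C K B \<and>
    (\<forall>T \<in> Obj C. \<forall>t \<in> Hom C T A. f \<cdot>\<^bsub>C\<^esub> t = zero_mor C T B \<longrightarrow>
      (\<exists>!u. u \<in> Hom C T K \<and> k \<cdot>\<^bsub>C\<^esub> u = t))"

text \<open>\<open>is_cokernel C A B f Q c\<close>: the morphism \<open>c : B \<rightarrow> Q\<close> is a cokernel of \<open>f : A \<rightarrow> B\<close>.\<close>

definition is_cokernel :: "('o, 'm) cat \<Rightarrow> 'o \<Rightarrow> 'o \<Rightarrow> 'm \<Rightarrow> 'o \<Rightarrow> 'm \<Rightarrow> bool" where
  "is_cokernel C A B f Q c \<longleftrightarrow>
    A \<in> Obj C \<and> B \<in> Obj C \<and> Q \<in> Obj C \<and> f \<in> Hom C A B \<and> c \<in> Hom C B Q \<and>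
    c \<cdot>\<^bsub>C\<^esub> f = zero_mor C A Q \<and>
    (\<forall>T \<in> Obj C. \<forall>t \<in> Hom C B T. t \<cdot>\<^bsub>C\<^esub> f = zero_mor C A T \<longrightarrow>
      (\<exists>!u. u \<in> Hom C Q T \<and> u \<cdot>\<^bsub>C\<^esub> c = t))"

locale abelian_category = additive_category +
  assumes kernel_exists:
      "\<lbrakk>A \<in> Obj C; B \<in> Obj C; f \<in> Hom C A B\<rbrakk> \<Longrightarrow> \<exists>K k. is_kernel C A B f K k"
    and cokernel_exists:
      "\<lbrakk>A \<in> Obj C; B \<in> Obj C; f \<in> Hom C A B\<rbrakk> \<Longrightarrow> \<exists>Q c. is_cokernel C A B f Q c"
    and mono_is_kernel: "is_mono C A B f \<Longrightarrow> \<exists>D g. is_kernel C B D g A f"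
    and epi_is_cokernel: "is_epi C A B f \<Longrightarrow> \<exists>D g. is_cokernel C D A g B f"

definition split_idempotents :: "('o, 'm) cat \<Rightarrow> bool" where
  "split_idempotents C \<longleftrightarrow>
    (\<forall>A \<in> Obj C. \<forall>e \<in> Hom C A A. e \<cdot>\<^bsub>C\<^esub> e = e \<longrightarrow>
      (\<exists>B \<in> Obj C. \<exists>p \<in> Hom C A B. \<exists>i \<in> Hom C B A.
        e = i \<cdot>\<^bsub>C\<^esub> p \<and> p \<cdot>\<^bsub>C\<^esub> i = Ident C B))"


section \<open>Subcategories\<close>

text \<open>
  All subcategories are full and closed under isomorphisms. The operation \<open>full_on C S\<close>
  only replaces the class of objects, because values of \<open>HomGrp\<close> outside \<open>Obj\<close> are
  irrelevant; so two full subcategories of \<open>C\<close> are equal iff they have the same objects.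
\<close>

definition full_on :: "('o, 'm) cat \<Rightarrow> 'o set \<Rightarrow> ('o, 'm) cat" where
  "full_on C S = C\<lparr>Obj := S\<rparr>"

definition subcategory :: "('o, 'm) cat \<Rightarrow> ('o, 'm) cat \<Rightarrow> bool" where
  "subcategory C X \<longleftrightarrow>
    Obj X \<subseteq> Obj C \<and> X = full_on C (Obj X) \<and>
    (\<forall>A \<in> Obj X. \<forall>B \<in> Obj C. isomorphic C A B \<longrightarrow> B \<in> Obj X)"

definition additive_subcategory :: "('o, 'm) cat \<Rightarrow> ('o, 'm) cat \<Rightarrow> bool" where
  "additive_subcategory C X \<longleftrightarrow> subcategory C X \<and> additive_category X"

definition closed_under_summands :: "('o, 'm) cat \<Rightarrow> ('o, 'm) cat \<Rightarrow> bool" where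
  "closed_under_summands C X \<longleftrightarrow>
    (\<forall>S \<in> Obj X. \<forall>A B. is_biproduct C A B S \<longrightarrow> A \<in> Obj X)"


section \<open>Precovers and preenvelopes\<close>

definition rel_epi :: "('o, 'm) cat \<Rightarrow> 'o set \<Rightarrow> 'o \<Rightarrow> 'o \<Rightarrow> 'm \<Rightarrow> bool" where
  "rel_epi C X A B f \<longleftrightarrow>
    A \<in> Obj C \<and> B \<in> Obj C \<and> f \<in> Hom C A B \<and>
    (\<forall>T \<in> X. (\<lambda>g. f \<cdot>\<^bsub>C\<^esub> g) ` Hom C T A = Hom C T B)"

definition rel_mono :: "('o, 'm) cat \<Rightarrow> 'o set \<Rightarrow> 'o \<Rightarrow> 'o \<Rightarrow> 'm \<Rightarrow> bool" where
  "rel_mono C X A B f \<longleftrightarrow>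
    A \<in> Obj C \<and> B \<in> Obj C \<and> f \<in> Hom C A B \<and>
    (\<forall>T \<in> X. (\<lambda>g. g \<cdot>\<^bsub>C\<^esub> f) ` Hom C B T = Hom C A T)"

definition is_precover :: "('o, 'm) cat \<Rightarrow> 'o set \<Rightarrow> 'o \<Rightarrow> 'o \<Rightarrow> 'm \<Rightarrow> bool" where
  "is_precover C X A T p \<longleftrightarrow> T \<in> X \<and> rel_epi C X T A p"

definition is_preenvelope :: "('o, 'm) cat \<Rightarrow> 'o set \<Rightarrow> 'o \<Rightarrow> 'o \<Rightarrow> 'm \<Rightarrow> bool" where
  "is_preenvelope C X A T j \<longleftrightarrow> T \<in> X \<and> rel_mono C X A T j"

definition precovering :: "('o, 'm) cat \<Rightarrow> ('o, 'm) cat \<Rightarrow> bool" where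
  "precovering C X \<longleftrightarrow> (\<forall>A \<in> Obj C. \<exists>T p. is_precover C (Obj X) A T p)"

definition preenveloping :: "('o, 'm) cat \<Rightarrow> ('o, 'm) cat \<Rightarrow> bool" where
  "preenveloping C X \<longleftrightarrow> (\<forall>A \<in> Obj C. \<exists>T j. is_preenvelope C (Obj X) A T j)"

definition weakly_resolving :: "('o, 'm) cat \<Rightarrow> ('o, 'm) cat \<Rightarrow> ('o, 'm) cat \<Rightarrow> bool" where
  "weakly_resolving C P X \<longleftrightarrow>
    additive_subcategory C X \<and> Obj P \<subseteq> Obj X \<and>
    (\<forall>A \<in> Obj X. \<exists>T p. is_precover C (Obj P) A T p) \<and>
    (\<forall>A \<in> Obj X. \<forall>B \<in> Obj X. \<forall>f K k.
      rel_epi C (Obj P) A B f \<and> is_kernel C A B f K k \<longrightarrow> K \<in> Obj X)"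

definition weakly_coresolving :: "('o, 'm) cat \<Rightarrow> ('o, 'm) cat \<Rightarrow> ('o, 'm) cat \<Rightarrow> bool" where
  "weakly_coresolving C P X \<longleftrightarrow>
    additive_subcategory C X \<and> Obj P \<subseteq> Obj X \<and>
    (\<forall>A \<in> Obj X. \<exists>T j. is_preenvelope C (Obj P) A T j) \<and>
    (\<forall>A \<in> Obj X. \<forall>B \<in> Obj X. \<forall>f Q c.
      rel_mono C (Obj P) A B f \<and> is_cokernel C A B f Q c \<longrightarrow> Q \<in> Obj X)"


section \<open>Functors, adjunctions, reflective and coreflective subcategories\<close>

record ('o, 'm, 'p, 'n) cat_functor =
  FObj :: "'o \<Rightarrow> 'p"
  FMap :: "'m \<Rightarrow> 'n"

definition is_functor ::
    "('o, 'm) cat \<Rightarrow> ('p, 'n) cat \<Rightarrow> ('o, 'm, 'p, 'n) cat_functor \<Rightarrow> bool" where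
  "is_functor C D F \<longleftrightarrow>
    (\<forall>A \<in> Obj C. FObj F A \<in> Obj D) \<and>
    (\<forall>A \<in> Obj C. \<forall>B \<in> Obj C. \<forall>f \<in> Hom C A B. FMap F f \<in> Hom D (FObj F A) (FObj F B)) \<and>
    (\<forall>A \<in> Obj C. FMap F (Ident C A) = Ident D (FObj F A)) \<and>
    (\<forall>A \<in> Obj C. \<forall>B \<in> Obj C. \<forall>E \<in> Obj C. \<forall>f \<in> Hom C A B. \<forall>g \<in> Hom C B E.
      FMap F (g \<cdot>\<^bsub>C\<^esub> f) = FMap F g \<cdot>\<^bsub>D\<^esub> FMap F f)"

text \<open>\<open>L : C \<rightarrow> D\<close> is left adjoint to \<open>R : D \<rightarrow> C\<close>, by natural bijections
  \<open>D(L A, B) \<cong> C(A, R B)\<close>.\<close>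

definition adjoint ::
    "('o, 'm) cat \<Rightarrow> ('p, 'n) cat \<Rightarrow> ('o, 'm, 'p, 'n) cat_functor
      \<Rightarrow> ('p, 'n, 'o, 'm) cat_functor \<Rightarrow> bool" where
  "adjoint C D L R \<longleftrightarrow>
    is_functor C D L \<and> is_functor D C R \<and>
    (\<exists>\<phi>. (\<forall>A \<in> Obj C. \<forall>B \<in> Obj D.
            bij_betw (\<phi> A B) (Hom D (FObj L A) B) (Hom C A (FObj R B))) \<and>
         (\<forall>A \<in> Obj C. \<forall>A' \<in> Obj C. \<forall>B \<in> Obj D. \<forall>B' \<in> Obj D.
            \<forall>a \<in> Hom C A' A. \<forall>b \<in> Hom D B B'. \<forall>h \<in> Hom D (FObj L A) B.
              \<phi> A' B' (b \<cdot>\<^bsub>D\<^esub> h \<cdot>\<^bsub>D\<^esub> FMap L a) = FMap R b \<cdot>\<^bsub>C\<^esub> \<phi> A B h \<cdot>\<^bsub>C\<^esub> a))"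

definition inclusion :: "('o, 'm, 'o, 'm) cat_functor" where
  "inclusion = \<lparr>FObj = (\<lambda>A. A), FMap = (\<lambda>f. f)\<rparr>"

definition reflective :: "('o, 'm) cat \<Rightarrow> ('o, 'm) cat \<Rightarrow> bool" where
  "reflective C X \<longleftrightarrow> subcategory C X \<and> (\<exists>L. adjoint C X L inclusion)"

definition coreflective :: "('o, 'm) cat \<Rightarrow> ('o, 'm) cat \<Rightarrow> bool" where
  "coreflective C X \<longleftrightarrow> subcategory C X \<and> (\<exists>R. adjoint X C inclusion R)"


section \<open>The stable category\<close>

definition factoring :: "('o, 'm) cat \<Rightarrow> ('o, 'm) cat \<Rightarrow> 'o \<Rightarrow> 'o \<Rightarrow> 'm set" where
  "factoring C P A B =
    {f \<in> Hom C A B. \<exists>Q \<in> Obj P. \<exists>u \<in> Hom C A Q. \<exists>v \<in> Hom C Q B. f = v \<cdot>\<^bsub>C\<^esub> u}"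

text \<open>The class in the stable category of a morphism \<open>f : A \<rightarrow> B\<close>.\<close>

definition stable_class :: "('o, 'm) cat \<Rightarrow> ('o, 'm) cat \<Rightarrow> 'o \<Rightarrow> 'o \<Rightarrow> 'm \<Rightarrow> 'm set" where
  "stable_class C P A B f = factoring C P A B #>\<^bsub>HomGrp C A B\<^esub> f"

text \<open>
  Composition of classes is given by composition of representatives. The union below is a
  single coset whenever \<open>F\<close> and \<open>G\<close> are composable: hom-sets are disjoint, so \<open>F\<close> and
  \<open>G\<close> determine \<open>A\<close>, \<open>B\<close> and \<open>D\<close>. The same device is used for the action of the loop and
  suspension functors on morphisms.
\<close>

definition stable :: "('o, 'm) cat \<Rightarrow> ('o, 'm) cat \<Rightarrow> ('o, 'm set) cat" where
  "stable C P =
    \<lparr>Obj = Obj C,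
     HomGrp = (\<lambda>A B. HomGrp C A B Mod factoring C P A B),
     Ident = (\<lambda>A. stable_class C P A A (Ident C A)),
     Comp = (\<lambda>G F. \<Union>{stable_class C P A D (g \<cdot>\<^bsub>C\<^esub> f) | A B D f g.
        A \<in> Obj C \<and> B \<in> Obj C \<and> D \<in> Obj C \<and>
        f \<in> F \<and> f \<in> Hom C A B \<and> g \<in> G \<and> g \<in> Hom C B D})\<rparr>"

text \<open>
  The loop functor depends on a choice, for each \<open>A\<close>, of a precover \<open>p : Q \<rightarrow> A\<close> and of a
  kernel \<open>k : K \<rightarrow> Q\<close> of \<open>p\<close>; \<open>loop_choice\<close> returns \<open>(Q, p, K, k)\<close>. Other choices
  give isomorphic objects of the stable category.
\<close>

definition loop_choice :: "('o, 'm) cat \<Rightarrow> ('o, 'm) cat \<Rightarrow> 'o \<Rightarrow> 'o \<times> 'm \<times> 'o \<times> 'm" where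
  "loop_choice C P A =
    (SOME (Q, p, K, k). is_precover C (Obj P) A Q p \<and> is_kernel C Q A p K k)"

definition loop_functor ::
    "('o, 'm) cat \<Rightarrow> ('o, 'm) cat \<Rightarrow> ('o, 'm set, 'o, 'm set) cat_functor" where
  "loop_functor C P =
    \<lparr>FObj = (\<lambda>A. case loop_choice C P A of (Q, p, K, k) \<Rightarrow> K),
     FMap = (\<lambda>F. \<Union>{stable_class C P K K' g | A B f Q p K k Q' p' K' k' h g.
        A \<in> Obj C \<and> B \<in> Obj C \<and> f \<in> F \<and> f \<in> Hom C A B \<and>
        loop_choice C P A = (Q, p, K, k) \<and> loop_choice C P B = (Q', p', K', k') \<and>
        h \<in> Hom C Q Q' \<and> p' \<cdot>\<^bsub>C\<^esub> h = f \<cdot>\<^bsub>C\<^esub> p \<and>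
        g \<in> Hom C K K' \<and> k' \<cdot>\<^bsub>C\<^esub> g = h \<cdot>\<^bsub>C\<^esub> k})\<rparr>"

text \<open>
  Dually, \<open>suspension_choice\<close> returns a preenvelope \<open>j : A \<rightarrow> Q\<close> and a cokernel
  \<open>c : Q \<rightarrow> K\<close> of \<open>j\<close>, in the form \<open>(Q, j, K, c)\<close>.
\<close>

definition suspension_choice :: "('o, 'm) cat \<Rightarrow> ('o, 'm) cat \<Rightarrow> 'o \<Rightarrow> 'o \<times> 'm \<times> 'o \<times> 'm" where
  "suspension_choice C P A =
    (SOME (Q, j, K, c). is_preenvelope C (Obj P) A Q j \<and> is_cokernel C A Q j K c)"

definition suspension_functor ::
    "('o, 'm) cat \<Rightarrow> ('o, 'm) cat \<Rightarrow> ('o, 'm set, 'o, 'm set) cat_functor" where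
  "suspension_functor C P =
    \<lparr>FObj = (\<lambda>A. case suspension_choice C P A of (Q, j, K, c) \<Rightarrow> K),
     FMap = (\<lambda>F. \<Union>{stable_class C P K K' g | A B f Q j K c Q' j' K' c' h g.
        A \<in> Obj C \<and> B \<in> Obj C \<and> f \<in> F \<and> f \<in> Hom C A B \<and>
        suspension_choice C P A = (Q, j, K, c) \<and> suspension_choice C P B = (Q', j', K', c') \<and>
        h \<in> Hom C Q Q' \<and> h \<cdot>\<^bsub>C\<^esub> j = j' \<cdot>\<^bsub>C\<^esub> f \<and>
        g \<in> Hom C K K' \<and> g \<cdot>\<^bsub>C\<^esub> c = c' \<cdot>\<^bsub>C\<^esub> h})\<rparr>"

text \<open>For a subcategory \<open>X\<close> containing \<open>P\<close>, this is \<open>X / P\<close>.\<close>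

definition stable_sub :: "('o, 'm) cat \<Rightarrow> ('o, 'm) cat \<Rightarrow> ('o, 'm) cat \<Rightarrow> ('o, 'm set) cat" where
  "stable_sub C P X = full_on (stable C P) (Obj X)"

end

theory Submission
  imports Defs
begin

text \<open>
  Part (2) is part (1) for the opposite category, so only (1) needs an argument.

  If \<open>X\<close> is preenveloping and weakly \<open>P\<close>-resolving, an \<open>X\<close>-preenvelope is a weakly universal arrow
  to \<open>X / P\<close> in the stable category. Its cokernel in \<open>C\<close> is a stable weak cokernel, and morphisms
  between objects of \<open>X\<close> have stable weak kernels in \<open>X\<close>; these produce an idempotent whose splitting
  is a reflection.

  Conversely, an object belongs to a reflective \<open>Y\<close> as soon as its reflection is a split
  monomorphism. For the kernel \<open>K\<close> of a \<open>P\<close>-epimorphism \<open>A \<rightarrow> B\<close> between objects of \<open>Y\<close> the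
  splitting is found in the sequence \<open>\<Omega> B \<rightarrow> K \<rightarrow> A \<rightarrow> B\<close>, in which every morphism is a stable weak
  kernel of the next: \<open>K \<rightarrow> A\<close> extends over the reflection and lifts back to \<open>K\<close>, and the
  error factors through \<open>\<Omega> B \<in> Y\<close>, hence through the reflection too.
\<close>

section \<open>Preadditive categories and reflections\<close>

text \<open>The stable category need not have kernels or cokernels. What descends from
  \<open>C\<close> has existence without uniqueness, so the uniqueness in a universal property must
  come from elsewhere: from splitting an idempotent, or from a reflection that is already given. The
  replacement for cancelling a monomorphism is subtraction: two morphisms with equal composites
  differ by a term through a weak kernel or a weak cokernel. One direction splits this error off,
  the other adds it to a retraction.

  The kernel condition on \<open>X\<close> concerns \<open>P\<close>-epimorphisms because for these
  a relation that holds only modulo \<open>P\<close> can be lifted to a relation in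
  \<open>C\<close>.

  A full subcategory is determined by its objects, and neither construction changes them. So
  injectivity and surjectivity are immediate, and the content is that each construction lands in the
  right class. Duality can be used by rewriting because forming the stable category commutes with
  passing to the opposite as an equality of records, and the choices behind the loop and suspension
  objects agree as well.\<close>

definition mor :: "('o, 'm) cat \<Rightarrow> 'o \<Rightarrow> 'o \<Rightarrow> 'm \<Rightarrow> bool" where
  "mor C A B f \<longleftrightarrow> A \<in> Obj C \<and> B \<in> Obj C \<and> f \<in> Hom C A B"

text \<open>Uniqueness of the factorisation is left out on purpose: the passage to the quotient
  modulo \<open>P\<close> keeps only the existence of lifts.\<close>

definition is_weak_kernel :: "('o, 'm) cat \<Rightarrow> 'o \<Rightarrow> 'o \<Rightarrow> 'm \<Rightarrow> 'o \<Rightarrow> 'm \<Rightarrow> bool" where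
  "is_weak_kernel C A B f K k \<longleftrightarrow>
    mor C A B f \<and> mor C K A k \<and> f \<cdot>\<^bsub>C\<^esub> k = zero_mor C K B \<and>
    (\<forall>T t. mor C T A t \<and> f \<cdot>\<^bsub>C\<^esub> t = zero_mor C T B \<longrightarrow> (\<exists>u. mor C T K u \<and> k \<cdot>\<^bsub>C\<^esub> u = t))"

definition is_weak_cokernel :: "('o, 'm) cat \<Rightarrow> 'o \<Rightarrow> 'o \<Rightarrow> 'm \<Rightarrow> 'o \<Rightarrow> 'm \<Rightarrow> bool" where
  "is_weak_cokernel C A B f Q c \<longleftrightarrow>
    mor C A B f \<and> mor C B Q c \<and> c \<cdot>\<^bsub>C\<^esub> f = zero_mor C A Q \<and>
    (\<forall>T t. mor C B T t \<and> t \<cdot>\<^bsub>C\<^esub> f = zero_mor C A T \<longrightarrow> (\<exists>u. mor C Q T u \<and> u \<cdot>\<^bsub>C\<^esub> c = t))"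

text \<open>The pointwise form of a left adjoint to the inclusion: it can be checked one object at a
  time, without functoriality or naturality. \<open>reflectiveD\<close> and
  \<open>reflectiveI\<close> translate.\<close>

definition is_reflection :: "('o, 'm) cat \<Rightarrow> 'o set \<Rightarrow> 'o \<Rightarrow> 'o \<Rightarrow> 'm \<Rightarrow> bool" where
  "is_reflection C X A B \<eta> \<longleftrightarrow>
    B \<in> X \<and> mor C A B \<eta> \<and>
    (\<forall>T \<in> X. \<forall>f. mor C A T f \<longrightarrow> (\<exists>!g. mor C B T g \<and> g \<cdot>\<^bsub>C\<^esub> \<eta> = f))"

lemma full_on_simps [simp]:
  "Obj (full_on C S) = S" "HomGrp (full_on C S) = HomGrp C"
  "Ident (full_on C S) = Ident C" "Comp (full_on C S) = Comp C"
  by (simp_all add: full_on_def)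

lemma inclusion_simps [simp]: "FObj inclusion A = A" "FMap inclusion f = f"
  by (simp_all add: inclusion_def)

lemma subcategoryD:
  assumes "subcategory C X"
  shows "Obj X \<subseteq> Obj C" "HomGrp X = HomGrp C" "Ident X = Ident C" "Comp X = Comp C"
    "\<And>A B. \<lbrakk>A \<in> Obj X; B \<in> Obj C; isomorphic C A B\<rbrakk> \<Longrightarrow> B \<in> Obj X"
proof -
  have X: "X = full_on C (Obj X)" using assms by (simp add: subcategory_def)
  show "Obj X \<subseteq> Obj C" "\<And>A B. \<lbrakk>A \<in> Obj X; B \<in> Obj C; isomorphic C A B\<rbrakk> \<Longrightarrow> B \<in> Obj X"
    using assms by (auto simp: subcategory_def)
  show "HomGrp X = HomGrp C" "Ident X = Ident C" "Comp X = Comp C"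
    by (subst X, simp)+
qed

text \<open>Both inclusions of the image equation are kept, since \<open>C\<close> is arbitrary here
  and \<open>X\<close> need not consist of objects, so composites are not known to be well
  typed.\<close>

lemma is_preenvelope_iff:
  "is_preenvelope C X A T j \<longleftrightarrow> T \<in> X \<and> mor C A T j \<and>
    (\<forall>Y \<in> X. (\<forall>g \<in> Hom C T Y. g \<cdot>\<^bsub>C\<^esub> j \<in> Hom C A Y) \<and>
              (\<forall>f \<in> Hom C A Y. \<exists>g \<in> Hom C T Y. g \<cdot>\<^bsub>C\<^esub> j = f))"
  unfolding is_preenvelope_def rel_mono_def mor_def by (auto simp: image_iff set_eq_iff) metis+

context preadditive_category
begin

section \<open>Arithmetic of morphisms in a preadditive category\<close>

lemma morD: "mor C A B f \<Longrightarrow> A \<in> Obj C" "mor C A B f \<Longrightarrow> B \<in> Obj C" "mor C A B f \<Longrightarrow> f \<in> Hom C A B"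
  by (auto simp: mor_def)

lemma mor_unique: "\<lbrakk>mor C A B f; mor C A' B' f\<rbrakk> \<Longrightarrow> A = A' \<and> B = B'"
  using hom_disjoint unfolding mor_def by blast

lemma mor_ident: "A \<in> Obj C \<Longrightarrow> mor C A A (Ident C A)"
  by (simp add: mor_def ident_closed)

lemma mor_comp: "\<lbrakk>mor C A B f; mor C B D g\<rbrakk> \<Longrightarrow> mor C A D (g \<cdot> f)"
  using comp_closed by (auto simp: mor_def)

lemma assoc: "\<lbrakk>mor C A B f; mor C B D g; mor C D E h\<rbrakk> \<Longrightarrow> h \<cdot> g \<cdot> f = h \<cdot> (g \<cdot> f)"
  using comp_assoc[of A B D E f g h] by (auto simp: mor_def)

lemma id_right: "mor C A B f \<Longrightarrow> f \<cdot> Ident C A = f"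
  using comp_ident unfolding mor_def by blast

lemma id_left: "mor C A B f \<Longrightarrow> Ident C B \<cdot> f = f"
  using ident_comp unfolding mor_def by blast

lemma hom_group: "\<lbrakk>A \<in> Obj C; B \<in> Obj C\<rbrakk> \<Longrightarrow> group (HomGrp C A B)"
  using hom_comm_group comm_group.axioms(2) by blast

lemma mor_zero: "\<lbrakk>A \<in> Obj C; B \<in> Obj C\<rbrakk> \<Longrightarrow> mor C A B (zero_mor C A B)"
  using hom_group by (simp add: mor_def group.is_monoid monoid.one_closed)

lemma mor_add: "\<lbrakk>mor C A B f; mor C A B g\<rbrakk> \<Longrightarrow> mor C A B (f \<otimes>\<^bsub>HomGrp C A B\<^esub> g)"
  using hom_group by (simp add: mor_def group.is_monoid monoid.m_closed)

lemma mor_neg: "mor C A B f \<Longrightarrow> mor C A B (inv\<^bsub>HomGrp C A B\<^esub> f)"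
  using hom_group by (simp add: mor_def group.inv_closed)

lemma add_commute: "\<lbrakk>mor C A B f; mor C A B g\<rbrakk> \<Longrightarrow> f \<otimes>\<^bsub>HomGrp C A B\<^esub> g = g \<otimes>\<^bsub>HomGrp C A B\<^esub> f"
  using hom_comm_group by (simp add: mor_def comm_group_def comm_monoid.m_comm)

lemma add_assoc: "\<lbrakk>mor C A B f; mor C A B g; mor C A B h\<rbrakk> \<Longrightarrow>
    f \<otimes>\<^bsub>HomGrp C A B\<^esub> g \<otimes>\<^bsub>HomGrp C A B\<^esub> h = f \<otimes>\<^bsub>HomGrp C A B\<^esub> (g \<otimes>\<^bsub>HomGrp C A B\<^esub> h)"
  using hom_group by (simp add: mor_def group.is_monoid monoid.m_assoc)

lemma add_zero: "mor C A B f \<Longrightarrow> f \<otimes>\<^bsub>HomGrp C A B\<^esub> zero_mor C A B = f"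
  using hom_group by (simp add: mor_def group.is_monoid)

lemma zero_add: "mor C A B f \<Longrightarrow> zero_mor C A B \<otimes>\<^bsub>HomGrp C A B\<^esub> f = f"
  using hom_group by (simp add: mor_def group.is_monoid)

lemma add_neg: "mor C A B f \<Longrightarrow> f \<otimes>\<^bsub>HomGrp C A B\<^esub> inv\<^bsub>HomGrp C A B\<^esub> f = zero_mor C A B"
  using hom_group by (simp add: mor_def group.r_inv)

lemma comp_add: "\<lbrakk>mor C A B f; mor C A B f'; mor C B D g\<rbrakk> \<Longrightarrow>
    g \<cdot> (f \<otimes>\<^bsub>HomGrp C A B\<^esub> f') = g \<cdot> f \<otimes>\<^bsub>HomGrp C A D\<^esub> (g \<cdot> f')"
  using comp_additive_right[of A B D g] by (auto simp: mor_def hom_def)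

lemma add_comp: "\<lbrakk>mor C A B f; mor C B D g; mor C B D g'\<rbrakk> \<Longrightarrow>
    (g \<otimes>\<^bsub>HomGrp C B D\<^esub> g') \<cdot> f = g \<cdot> f \<otimes>\<^bsub>HomGrp C A D\<^esub> (g' \<cdot> f)"
  using comp_additive_left[of A B D f] by (auto simp: mor_def hom_def)

lemma comp_zero: assumes "A \<in> Obj C" "mor C B D g"
  shows "g \<cdot> zero_mor C A B = zero_mor C A D"
proof -
  have "group_hom (HomGrp C A B) (HomGrp C A D) (\<lambda>f. g \<cdot> f)"
    using assms comp_additive_right hom_group
    by (simp add: mor_def group_hom_def group_hom_axioms_def)
  then show ?thesis using group_hom.hom_one by fastforce
qed

lemma zero_comp: assumes "mor C A B f" "D \<in> Obj C"
  shows "zero_mor C B D \<cdot> f = zero_mor C A D"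
proof -
  have "group_hom (HomGrp C B D) (HomGrp C A D) (\<lambda>g. g \<cdot> f)"
    using assms comp_additive_left hom_group
    by (simp add: mor_def group_hom_def group_hom_axioms_def)
  then show ?thesis using group_hom.hom_one by fastforce
qed

lemma neg_comp: assumes "mor C A B f" "mor C B D g"
  shows "(inv\<^bsub>HomGrp C B D\<^esub> g) \<cdot> f = inv\<^bsub>HomGrp C A D\<^esub> (g \<cdot> f)"
proof -
  have "group_hom (HomGrp C B D) (HomGrp C A D) (\<lambda>g. g \<cdot> f)"
    using assms comp_additive_left hom_group
    by (simp add: mor_def group_hom_def group_hom_axioms_def)
  then show ?thesis using group_hom.hom_inv assms(2) by (fastforce simp: mor_def)
qed

lemma comp_neg: assumes "mor C A B f" "mor C B D g"
  shows "g \<cdot> (inv\<^bsub>HomGrp C A B\<^esub> f) = inv\<^bsub>HomGrp C A D\<^esub> (g \<cdot> f)"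
proof -
  have "group_hom (HomGrp C A B) (HomGrp C A D) (\<lambda>f. g \<cdot> f)"
    using assms comp_additive_right hom_group
    by (simp add: mor_def group_hom_def group_hom_axioms_def)
  then show ?thesis using group_hom.hom_inv assms(1) by (fastforce simp: mor_def)
qed

lemma add_diff: assumes "mor C A B f" "mor C A B g"
  shows "g \<otimes>\<^bsub>HomGrp C A B\<^esub> (f \<otimes>\<^bsub>HomGrp C A B\<^esub> inv\<^bsub>HomGrp C A B\<^esub> g) = f"
  using assms by (metis add_assoc add_commute add_neg add_zero mor_neg)

lemma add_eq_self:
  assumes "mor C A B f" "mor C A B g" "f \<otimes>\<^bsub>HomGrp C A B\<^esub> g = f"
  shows "g = zero_mor C A B"
  using assms by (metis add_assoc add_commute add_neg add_zero mor_neg)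

text \<open>The difference of \<open>u\<close> and \<open>v\<close> is killed by \<open>f\<close>,
  hence lifts through \<open>k\<close>. This stands in for uniqueness: equality after
  \<open>f\<close> becomes equality up to an explicit term through \<open>K\<close>.\<close>

lemma weak_kernel_diff:
  assumes k: "is_weak_kernel C A B f K k" and u: "mor C T A u" and v: "mor C T A v"
    and eq: "f \<cdot> u = f \<cdot> v"
  obtains w where "mor C T K w" "u = v \<otimes>\<^bsub>HomGrp C T A\<^esub> (k \<cdot> w)"
proof -
  have f: "mor C A B f" using k by (simp add: is_weak_kernel_def)
  let ?d = "u \<otimes>\<^bsub>HomGrp C T A\<^esub> inv\<^bsub>HomGrp C T A\<^esub> v"
  have d: "mor C T A ?d" using u v by (simp add: mor_add mor_neg)
  have "f \<cdot> ?d = f \<cdot> u \<otimes>\<^bsub>HomGrp C T B\<^esub> inv\<^bsub>HomGrp C T B\<^esub> (f \<cdot> v)"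
    using u v f by (simp add: comp_add[of T A _ _ B] comp_neg[of T A _ B] mor_neg)
  also have "\<dots> = zero_mor C T B" using eq add_neg[OF mor_comp[OF v f]] by simp
  finally obtain w where "mor C T K w" "k \<cdot> w = ?d" using k d by (auto simp: is_weak_kernel_def)
  then show thesis using that add_diff[OF u v] by metis
qed

lemma weak_cokernel_diff:
  assumes c: "is_weak_cokernel C A B f Q c" and u: "mor C B T u" and v: "mor C B T v"
    and eq: "u \<cdot> f = v \<cdot> f"
  obtains w where "mor C Q T w" "u = v \<otimes>\<^bsub>HomGrp C B T\<^esub> (w \<cdot> c)"
proof -
  have f: "mor C A B f" using c by (simp add: is_weak_cokernel_def)
  let ?d = "u \<otimes>\<^bsub>HomGrp C B T\<^esub> inv\<^bsub>HomGrp C B T\<^esub> v"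
  have d: "mor C B T ?d" using u v by (simp add: mor_add mor_neg)
  have "?d \<cdot> f = u \<cdot> f \<otimes>\<^bsub>HomGrp C A T\<^esub> inv\<^bsub>HomGrp C A T\<^esub> (v \<cdot> f)"
    using u v f by (simp add: add_comp[of A B _ T] neg_comp[of A B _ T] mor_neg)
  also have "\<dots> = zero_mor C A T" using eq add_neg[OF mor_comp[OF f v]] by simp
  finally obtain w where "mor C Q T w" "w \<cdot> c = ?d" using c d by (auto simp: is_weak_cokernel_def)
  then show thesis using that add_diff[OF u v] by metis
qed

lemma is_kernelD:
  assumes "is_kernel C A B f K k"
  shows "mor C A B f" "mor C K A k" "f \<cdot> k = zero_mor C K B"
    "\<And>T t. \<lbrakk>mor C T A t; f \<cdot> t = zero_mor C T B\<rbrakk> \<Longrightarrow> \<exists>u. mor C T K u \<and> k \<cdot> u = t"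
  using assms by (auto simp: is_kernel_def mor_def) metis

lemma kernel_mono:
  assumes "is_kernel C A B f K k" "mor C T K u" "mor C T K v" "k \<cdot> u = k \<cdot> v"
  shows "u = v"
proof -
  have f: "mor C A B f" "mor C K A k" "f \<cdot> k = zero_mor C K B" using is_kernelD[OF assms(1)] by auto
  have "f \<cdot> (k \<cdot> v) = zero_mor C T B"
    using assoc[OF assms(3) f(2) f(1)] f zero_comp[OF assms(3)] by (metis morD(2))
  then show ?thesis using assms f mor_comp[OF assms(3) f(2)] unfolding is_kernel_def mor_def by metis
qed

lemma kernel_weak_kernel: "is_kernel C A B f K k \<Longrightarrow> is_weak_kernel C A B f K k"
  unfolding is_weak_kernel_def by (auto dest: is_kernelD)

lemma is_biproductE:
  assumes "is_biproduct C A B S"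
  obtains i j p q where "mor C A S i" "mor C B S j" "mor C S A p" "mor C S B q"
    "p \<cdot> i = Ident C A" "q \<cdot> j = Ident C B" "q \<cdot> i = zero_mor C A B" "p \<cdot> j = zero_mor C B A"
    "(i \<cdot> p) \<otimes>\<^bsub>HomGrp C S S\<^esub> (j \<cdot> q) = Ident C S"
  using assms unfolding is_biproduct_def mor_def by blast

lemma is_biproductI:
  assumes i: "mor C A S i" and j: "mor C B S j" and p: "mor C S A p" and q: "mor C S B q"
    and "p \<cdot> i = Ident C A" "q \<cdot> j = Ident C B" "q \<cdot> i = zero_mor C A B" "p \<cdot> j = zero_mor C B A"
    and "(i \<cdot> p) \<otimes>\<^bsub>HomGrp C S S\<^esub> (j \<cdot> q) = Ident C S"
  shows "is_biproduct C A B S"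
  unfolding is_biproduct_def
  by (intro conjI morD(1)[OF i] morD(1)[OF j] morD(2)[OF i]
      bexI[OF _ morD(3)[OF i]] bexI[OF _ morD(3)[OF j]] bexI[OF _ morD(3)[OF p]] bexI[OF _ morD(3)[OF q]])
    fact+

text \<open>Take the column \<open>(u, v)\<close> and the row \<open>[f, g]\<close>. This turns a
  sum of two factorisations into one factorisation, both for sums of morphisms through
  \<open>P\<close> and for an identity that splits only up to a term through
  \<open>P\<close>.\<close>

lemma biproduct_factor:
  assumes bip: "is_biproduct C A B S" and u: "mor C T A u" and f: "mor C A D f"
    and v: "mor C T B v" and g: "mor C B D g"
  obtains a b where "mor C T S a" "mor C S D b" "b \<cdot> a = f \<cdot> u \<otimes>\<^bsub>HomGrp C T D\<^esub> (g \<cdot> v)"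
proof -
  obtain i j p q where i: "mor C A S i" and j: "mor C B S j" and p: "mor C S A p" and q: "mor C S B q"
    and eq: "p \<cdot> i = Ident C A" "q \<cdot> j = Ident C B" "q \<cdot> i = zero_mor C A B" "p \<cdot> j = zero_mor C B A"
    using is_biproductE[OF bip] by metis
  let ?a = "(i \<cdot> u) \<otimes>\<^bsub>HomGrp C T S\<^esub> (j \<cdot> v)" and ?b = "(f \<cdot> p) \<otimes>\<^bsub>HomGrp C S D\<^esub> (g \<cdot> q)"
  note iu = mor_comp[OF u i] and jv = mor_comp[OF v j]
  have a: "mor C T S ?a" using mor_add[OF iu jv] .
  have b: "mor C S D ?b" using mor_add[OF mor_comp[OF p f] mor_comp[OF q g]] .
  have "p \<cdot> ?a = u" "q \<cdot> ?a = v"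
    using comp_add[OF iu jv p] comp_add[OF iu jv q] assoc[OF u i p] assoc[OF v j p] assoc[OF u i q]
      assoc[OF v j q] eq id_left[OF u] id_left[OF v] zero_comp[OF u morD(2)[OF v]]
      zero_comp[OF v morD(2)[OF u]] add_zero[OF u] zero_add[OF v] by simp_all
  then have "?b \<cdot> ?a = f \<cdot> u \<otimes>\<^bsub>HomGrp C T D\<^esub> (g \<cdot> v)"
    using add_comp[OF a mor_comp[OF p f] mor_comp[OF q g]] assoc[OF a p f] assoc[OF a q g] by simp
  then show thesis using that a b by blast
qed

text \<open>A weakly universal arrow \<open>j\<close> becomes universal after splitting off a redundant part: an
  endomorphism \<open>i \<cdot> s\<close> with \<open>i \<cdot> s \<cdot> j = j\<close> that factors through the weak kernel \<open>i\<close> of \<open>l \<cdot> c\<close> is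
  idempotent, because its complement factors through \<open>l \<cdot> c\<close>.\<close>

lemma reflection_exists:
  assumes split: "split_idempotents C" and X: "X \<subseteq> Obj C"
    and retract: "\<And>A B f g. \<lbrakk>A \<in> X; mor C A B f; mor C B A g; f \<cdot> g = Ident C B\<rbrakk> \<Longrightarrow> B \<in> X"
    and j: "is_preenvelope C X A X0 j" and c: "is_weak_cokernel C A X0 j Q c"
    and l: "is_preenvelope C X Q X1 l" and i: "is_weak_kernel C X0 X1 (l \<cdot> c) K i" and K: "K \<in> X"
  shows "\<exists>B p. is_reflection C X A B p"
proof -
  have X0: "X0 \<in> X" and mj: "mor C A X0 j" using j by (auto simp: is_preenvelope_iff)
  have ml: "mor C Q X1 l" using l by (auto simp: is_preenvelope_iff)
  have mc: "mor C X0 Q c" using c by (auto simp: is_weak_cokernel_def)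
  have mi: "mor C K X0 i" using i by (auto simp: is_weak_kernel_def)
  note d = mor_comp[OF mc ml]
  have j_lift: "\<exists>g. mor C X0 T g \<and> g \<cdot> j = f" if "T \<in> X" "mor C A T f" for T f
    using j that X X0 by (auto simp: is_preenvelope_iff mor_def) blast
  \<comment> \<open>Agreement on \<open>j\<close> puts the difference of \<open>u\<close> and
    \<open>v\<close> through \<open>c\<close>; as its target lies in \<open>X\<close>, the remaining
    factor from \<open>Q\<close> extends over the preenvelope \<open>l\<close>. So the difference
    passes through \<open>l \<cdot> c\<close>.\<close>
  have kill: "\<exists>h. mor C X1 T h \<and> u = v \<otimes>\<^bsub>HomGrp C X0 T\<^esub> (h \<cdot> (l \<cdot> c))"
    if T: "T \<in> X" and uv: "mor C X0 T u" "mor C X0 T v" "u \<cdot> j = v \<cdot> j" for T u v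
  proof -
    obtain w where w: "mor C Q T w" "u = v \<otimes>\<^bsub>HomGrp C X0 T\<^esub> (w \<cdot> c)"
      using weak_cokernel_diff[OF c uv] by blast
    obtain h where h: "h \<in> Hom C X1 T" "h \<cdot> l = w"
      using l w(1) T unfolding is_preenvelope_iff mor_def by blast
    have "mor C X1 T h" using h w ml by (auto simp: mor_def)
    then show ?thesis using w h assoc[OF mc ml] by metis
  qed
  have "l \<cdot> c \<cdot> j = zero_mor C A X1"
    using c assoc[OF mj mc ml] comp_zero[OF morD(1)[OF mj] ml] by (simp add: is_weak_cokernel_def)
  then obtain a where a: "mor C A K a" "i \<cdot> a = j"
    using i mj by (auto simp: is_weak_kernel_def)
  \<comment> \<open>Because \<open>K\<close> is in \<open>X\<close>, the lift \<open>a\<close> of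
    \<open>j\<close> extends over \<open>j\<close> itself. The endomorphism
    \<open>i \<cdot> s\<close> of \<open>X0\<close> then agrees with the identity on
    \<open>j\<close>.\<close>
  obtain s where s: "mor C X0 K s" "s \<cdot> j = a" using j_lift[OF K a(1)] by blast
  note e = mor_comp[OF s(1) mi]
  have id: "mor C X0 X0 (Ident C X0)" using mor_ident X X0 by blast
  have "Ident C X0 \<cdot> j = i \<cdot> s \<cdot> j" using assoc[OF mj s(1) mi] s a id_left[OF mj] by simp
  then obtain r where r: "mor C X1 X0 r" "Ident C X0 = i \<cdot> s \<otimes>\<^bsub>HomGrp C X0 X0\<^esub> (r \<cdot> (l \<cdot> c))"
    using kill[OF X0 id e] by blast
  have di: "l \<cdot> c \<cdot> i = zero_mor C K X1" using i by (simp add: is_weak_kernel_def)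
  have "i = (i \<cdot> s \<otimes>\<^bsub>HomGrp C X0 X0\<^esub> (r \<cdot> (l \<cdot> c))) \<cdot> i" using r(2) id_left[OF mi] by simp
  also have "\<dots> = i \<cdot> s \<cdot> i \<otimes>\<^bsub>HomGrp C K X0\<^esub> (r \<cdot> (l \<cdot> c) \<cdot> i)"
    by (rule add_comp[OF mi e mor_comp[OF d r(1)]])
  also have "r \<cdot> (l \<cdot> c) \<cdot> i = zero_mor C K X0"
    using assoc[OF mi d r(1)] di comp_zero[OF morD(1)[OF mi] r(1)] by simp
  also have "i \<cdot> s \<cdot> i \<otimes>\<^bsub>HomGrp C K X0\<^esub> zero_mor C K X0 = i \<cdot> s \<cdot> i"
    by (rule add_zero[OF mor_comp[OF mi e]])
  finally have isi: "i \<cdot> s \<cdot> i = i" by simp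
  have "i \<cdot> s \<cdot> (i \<cdot> s) = i \<cdot> s" using assoc[OF s(1) mi e] isi by simp
  then obtain B p q where B: "B \<in> Obj C" "p \<in> Hom C X0 B" "q \<in> Hom C B X0"
      "i \<cdot> s = q \<cdot> p" "p \<cdot> q = Ident C B"
    using split e unfolding split_idempotents_def mor_def by metis
  have p: "mor C X0 B p" and q: "mor C B X0 q" using B X X0 by (auto simp: mor_def)
  have BX: "B \<in> X" using retract[OF X0 p q B(5)] .
  note pj = mor_comp[OF mj p]
  have qpj: "q \<cdot> (p \<cdot> j) = j"
    using assoc[OF mj p q] B(4) assoc[OF mj s(1) mi] s a by simp
  \<comment> \<open>Since \<open>q\<close> equals \<open>i \<cdot> (s \<cdot> q)\<close>, it
    inherits from \<open>i\<close> that \<open>l \<cdot> c\<close> kills it. In the uniqueness proof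
    below this removes the error term supplied by \<open>kill\<close>.\<close>
  have dq: "l \<cdot> c \<cdot> q = zero_mor C B X1"
  proof -
    have "q = q \<cdot> (p \<cdot> q)" using B(5) id_right[OF q] by simp
    also have "\<dots> = i \<cdot> (s \<cdot> q)" using assoc[OF q p q] B(4) assoc[OF q s(1) mi] by simp
    finally have "l \<cdot> c \<cdot> q = l \<cdot> c \<cdot> i \<cdot> (s \<cdot> q)" using assoc[OF mor_comp[OF q s(1)] mi d] by simp
    then show ?thesis using di zero_comp[OF mor_comp[OF q s(1)] morD(2)[OF ml]] by simp
  qed
  have "\<exists>!g. mor C B T g \<and> g \<cdot> (p \<cdot> j) = f" if T: "T \<in> X" and f: "mor C A T f" for T f
  proof (rule ex_ex1I)
    obtain g where g: "mor C X0 T g" "g \<cdot> j = f" using j_lift[OF T f] by blast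
    have "g \<cdot> q \<cdot> (p \<cdot> j) = f" using assoc[OF pj q g(1)] qpj g by simp
    then show "\<exists>g. mor C B T g \<and> g \<cdot> (p \<cdot> j) = f" using mor_comp[OF q g(1)] by blast
  next
    fix g g' assume g: "mor C B T g \<and> g \<cdot> (p \<cdot> j) = f" and g': "mor C B T g' \<and> g' \<cdot> (p \<cdot> j) = f"
    then have "g \<cdot> p \<cdot> j = g' \<cdot> p \<cdot> j" using assoc[OF mj p] by metis
    then obtain h where h: "mor C X1 T h" "g \<cdot> p = g' \<cdot> p \<otimes>\<^bsub>HomGrp C X0 T\<^esub> (h \<cdot> (l \<cdot> c))"
      using kill[OF T] mor_comp[OF p] g g' by meson
    have "g = g \<cdot> p \<cdot> q" using assoc[OF q p] g B(5) id_right by metis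
    also have "\<dots> = g' \<cdot> p \<cdot> q \<otimes>\<^bsub>HomGrp C B T\<^esub> (h \<cdot> (l \<cdot> c) \<cdot> q)"
      unfolding h(2) by (rule add_comp[OF q mor_comp[OF p] mor_comp[OF d h(1)]]) (use g' in simp)
    also have "g' \<cdot> p \<cdot> q = g'" using assoc[OF q p] g' B(5) id_right by metis
    also have "h \<cdot> (l \<cdot> c) \<cdot> q = zero_mor C B T"
      using assoc[OF q d h(1)] dq comp_zero[OF B(1) h(1)] by simp
    also have "g' \<otimes>\<^bsub>HomGrp C B T\<^esub> zero_mor C B T = g'" using add_zero g' by blast
    finally show "g = g'" .
  qed
  then show ?thesis using BX pj unfolding is_reflection_def by blast
qed

section \<open>Universal arrows and adjoints of the inclusion\<close>

lemma reflectiveD: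
  assumes "reflective C X" "A \<in> Obj C"
  shows "\<exists>B \<eta>. is_reflection C (Obj X) A B \<eta>"
proof -
  have sub: "subcategory C X" using assms(1) by (simp add: reflective_def)
  note X = subcategoryD[OF sub]
  obtain L \<phi> where L: "is_functor C X L"
    and bij: "\<And>A B. \<lbrakk>A \<in> Obj C; B \<in> Obj X\<rbrakk> \<Longrightarrow> bij_betw (\<phi> A B) (Hom C (FObj L A) B) (Hom C A B)"
    and nat: "\<And>A A' B B' a b h. \<lbrakk>A \<in> Obj C; A' \<in> Obj C; B \<in> Obj X; B' \<in> Obj X;
       a \<in> Hom C A' A; b \<in> Hom C B B'; h \<in> Hom C (FObj L A) B\<rbrakk> \<Longrightarrow>
       \<phi> A' B' (b \<cdot> h \<cdot> FMap L a) = b \<cdot> \<phi> A B h \<cdot> a"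
    using assms(1) unfolding reflective_def adjoint_def X inclusion_simps by blast
  let ?B = "FObj L A"
  have B: "?B \<in> Obj X" using L assms(2) by (auto simp: is_functor_def)
  have BC: "?B \<in> Obj C" using B X by auto
  have L1: "FMap L (Ident C A) = Ident C ?B" using L assms(2) by (auto simp: is_functor_def X)
  let ?\<eta> = "\<phi> A ?B (Ident C ?B)"
  have \<eta>: "mor C A ?B ?\<eta>"
    using bij_betwE[OF bij[OF assms(2) B]] ident_closed[OF BC] assms(2) BC by (auto simp: mor_def)
  \<comment> \<open>The Yoneda argument: naturality in the second variable, applied to the identity
    of \<open>?B\<close>, shows that the whole bijection is composition with the unit
    \<open>?\<eta>\<close>.\<close>
  have \<phi>: "\<phi> A T g = g \<cdot> ?\<eta>" if T: "T \<in> Obj X" and g: "mor C ?B T g" for T g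
  proof -
    have "\<phi> A T (g \<cdot> Ident C ?B \<cdot> FMap L (Ident C A)) = g \<cdot> ?\<eta> \<cdot> Ident C A"
      using nat[OF assms(2) assms(2) B T ident_closed[OF assms(2)]] g ident_closed[OF BC]
      by (auto simp: mor_def)
    then show ?thesis using L1 id_right[OF g] id_right[OF mor_comp[OF \<eta> g]] by simp
  qed
  have "\<exists>!g. mor C ?B T g \<and> g \<cdot> ?\<eta> = f" if T: "T \<in> Obj X" and f: "mor C A T f" for T f
  proof -
    have "\<exists>!g. g \<in> Hom C ?B T \<and> \<phi> A T g = f"
      using bij[OF assms(2) T] f by (auto simp: mor_def bij_betw_def inj_on_def) (metis imageE)
    moreover have "mor C ?B T g \<longleftrightarrow> g \<in> Hom C ?B T" for g using BC T X by (auto simp: mor_def)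
    ultimately show ?thesis using \<phi>[OF T] by metis
  qed
  then show ?thesis using B \<eta> unfolding is_reflection_def by blast
qed

lemma reflectiveI:
  assumes sub: "subcategory C X" and ex: "\<And>A. A \<in> Obj C \<Longrightarrow> \<exists>B \<eta>. is_reflection C (Obj X) A B \<eta>"
  shows "reflective C X"
proof -
  note X = subcategoryD[OF sub]
  obtain F \<eta> where refl: "\<And>A. A \<in> Obj C \<Longrightarrow> is_reflection C (Obj X) A (F A) (\<eta> A)"
    using ex by metis
  have F: "F A \<in> Obj X" and \<eta>: "mor C A (F A) (\<eta> A)" if "A \<in> Obj C" for A
    using refl[OF that] by (auto simp: is_reflection_def)
  have univ: "\<exists>!g. mor C (F A) T g \<and> g \<cdot> \<eta> A = f" if "T \<in> Obj X" "mor C A T f" for A T f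
    using refl[OF morD(1)[OF that(2)]] that by (auto simp: is_reflection_def)
  \<comment> \<open>A functor acts on bare morphisms, which do not carry their endpoints. The
    description therefore quantifies over \<open>A\<close> and \<open>B\<close>, and disjointness of
    hom-sets makes them unique.\<close>
  define L where "L f = (THE g. \<exists>A B. mor C A B f \<and> mor C (F A) (F B) g \<and> g \<cdot> \<eta> A = \<eta> B \<cdot> f)" for f
  have Lf: "mor C (F A) (F B) (L f) \<and> L f \<cdot> \<eta> A = \<eta> B \<cdot> f" if f: "mor C A B f" for A B f
  proof -
    have "\<exists>!g. mor C (F A) (F B) g \<and> g \<cdot> \<eta> A = \<eta> B \<cdot> f"
      by (rule univ[OF F[OF morD(2)[OF f]] mor_comp[OF f \<eta>[OF morD(2)[OF f]]]])
    moreover have "(\<exists>A' B'. mor C A' B' f \<and> mor C (F A') (F B') g \<and> g \<cdot> \<eta> A' = \<eta> B' \<cdot> f)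
        \<longleftrightarrow> mor C (F A) (F B) g \<and> g \<cdot> \<eta> A = \<eta> B \<cdot> f" for g
      using f mor_unique[OF f] by metis
    ultimately show ?thesis unfolding L_def by (simp only:) (rule theI')
  qed
  have uniq: "g = g'" if "T \<in> Obj X" "mor C (F A) T g" "mor C (F A) T g'" "g \<cdot> \<eta> A = g' \<cdot> \<eta> A" "A \<in> Obj C"
    for A T g g'
    using univ[OF that(1) mor_comp[OF \<eta>[OF that(5)] that(3)]] that by blast
  define LL where "LL = \<lparr>FObj = F, FMap = L\<rparr>"
  have [simp]: "FObj LL = F" "FMap LL = L" by (simp_all add: LL_def)
  have "is_functor C X LL"
  proof -
    have "L (Ident C A) = Ident C (F A)" if A: "A \<in> Obj C" for A
    proof (rule uniq[OF F[OF A] _ _ _ A])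
      note l = Lf[OF mor_ident[OF A]]
      have FA: "F A \<in> Obj C" using F A X by auto
      show "mor C (F A) (F A) (L (Ident C A))" "mor C (F A) (F A) (Ident C (F A))"
        using l mor_ident FA by auto
      show "L (Ident C A) \<cdot> \<eta> A = Ident C (F A) \<cdot> \<eta> A" using l id_right id_left \<eta>[OF A] by simp
    qed
    moreover have "L (g \<cdot> f) = L g \<cdot> L f" if f: "mor C A B f" and g: "mor C B D g" for A B D f g
    proof (rule uniq)
      note lf = Lf[OF f] and lg = Lf[OF g] and lgf = Lf[OF mor_comp[OF f g]]
      show "F D \<in> Obj X" using F morD g by auto
      show "mor C (F A) (F D) (L (g \<cdot> f))" "mor C (F A) (F D) (L g \<cdot> L f)" "A \<in> Obj C"
        using lf lg lgf mor_comp f morD by blast+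
      have "L g \<cdot> L f \<cdot> \<eta> A = L g \<cdot> (L f \<cdot> \<eta> A)"
        using assoc[OF \<eta>[OF morD(1)[OF f]]] lf lg by blast
      also have "\<dots> = L g \<cdot> \<eta> B \<cdot> f" using assoc[OF f \<eta>[OF morD(2)[OF f]]] lg lf by metis
      also have "\<dots> = \<eta> D \<cdot> (g \<cdot> f)" using lg assoc[OF f g \<eta>[OF morD(2)[OF g]]] by simp
      finally show "L (g \<cdot> f) \<cdot> \<eta> A = L g \<cdot> L f \<cdot> \<eta> A" using lgf by simp
    qed
    ultimately show ?thesis using F Lf by (auto simp: is_functor_def X mor_def)
  qed
  moreover have "is_functor X C inclusion"
    using X by (auto simp: is_functor_def)
  moreover have "\<forall>A\<in>Obj C. \<forall>B\<in>Obj X. bij_betw (\<lambda>h. h \<cdot> \<eta> A) (Hom C (F A) B) (Hom C A B)"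
  proof (intro ballI)
    fix A B assume A: "A \<in> Obj C" and B: "B \<in> Obj X"
    have mm: "mor C (F A) B g \<longleftrightarrow> g \<in> Hom C (F A) B" "mor C A B g \<longleftrightarrow> g \<in> Hom C A B" for g
      using F A B X by (auto simp: mor_def)
    show "bij_betw (\<lambda>h. h \<cdot> \<eta> A) (Hom C (F A) B) (Hom C A B)"
      unfolding bij_betw_def inj_on_def
      using uniq[OF B _ _ _ A] univ[OF B, of A] mor_comp[OF \<eta>[OF A], of B]
      unfolding mm by (auto simp: image_iff) metis
  qed
  moreover have "\<forall>A\<in>Obj C. \<forall>A'\<in>Obj C. \<forall>B\<in>Obj X. \<forall>B'\<in>Obj X. \<forall>a\<in>Hom C A' A. \<forall>b\<in>Hom C B B'.
      \<forall>h\<in>Hom C (F A) B. b \<cdot> h \<cdot> L a \<cdot> \<eta> A' = b \<cdot> (h \<cdot> \<eta> A) \<cdot> a"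
  proof (intro ballI)
    fix A A' B B' a b h assume *: "A \<in> Obj C" "A' \<in> Obj C" "B \<in> Obj X" "B' \<in> Obj X" "a \<in> Hom C A' A"
      "b \<in> Hom C B B'" "h \<in> Hom C (F A) B"
    then have a: "mor C A' A a" and b: "mor C B B' b" and h: "mor C (F A) B h"
      using X F by (auto simp: mor_def)
    note la = Lf[OF a]
    have "b \<cdot> h \<cdot> L a \<cdot> \<eta> A' = b \<cdot> h \<cdot> (L a \<cdot> \<eta> A')"
      using assoc[OF \<eta>[OF *(2)]] la mor_comp[OF h b] by blast
    also have "\<dots> = b \<cdot> h \<cdot> \<eta> A \<cdot> a" using la assoc[OF a \<eta>[OF *(1)] mor_comp[OF h b]] by simp
    finally show "b \<cdot> h \<cdot> L a \<cdot> \<eta> A' = b \<cdot> (h \<cdot> \<eta> A) \<cdot> a" using assoc[OF \<eta>[OF *(1)] h b] by simp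
  qed
  ultimately have "adjoint C X LL inclusion"
    unfolding adjoint_def by (intro conjI exI[of _ "\<lambda>A B h. h \<cdot> \<eta> A"]) (auto simp: X)
  then show ?thesis using sub by (auto simp: reflective_def)
qed

section \<open>Closure properties of reflective subcategories\<close>

lemma isomorphicI:
  "\<lbrakk>f \<in> Hom C A B; g \<in> Hom C B A; g \<cdot> f = Ident C A; f \<cdot> g = Ident C B\<rbrakk> \<Longrightarrow> isomorphic C A B"
  by (auto simp: isomorphic_def)

text \<open>Both \<open>\<eta> \<cdot> r\<close> and the identity of \<open>B\<close> are
  factorisations of \<open>\<eta>\<close> over itself, so they agree and \<open>\<eta>\<close> is an
  isomorphism. Each closure property below comes down to constructing such an
  \<open>r\<close>.\<close>

lemma reflection_split:
  assumes sub: "subcategory C X" and refl: "is_reflection C (Obj X) A B \<eta>"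
    and r: "mor C B A r" "r \<cdot> \<eta> = Ident C A"
  shows "A \<in> Obj X"
proof -
  have B: "B \<in> Obj X" and \<eta>: "mor C A B \<eta>" using refl by (auto simp: is_reflection_def)
  have "mor C B B (\<eta> \<cdot> r)" "mor C B B (Ident C B)" using mor_comp \<eta> r mor_ident morD by blast+
  moreover have "\<eta> \<cdot> r \<cdot> \<eta> = \<eta>" using assoc[OF \<eta> r(1) \<eta>] r id_right[OF \<eta>] by simp
  moreover have "Ident C B \<cdot> \<eta> = \<eta>" by (rule id_left[OF \<eta>])
  ultimately have "\<eta> \<cdot> r = Ident C B" using refl B \<eta> unfolding is_reflection_def by blast
  then have "isomorphic C B A" using isomorphicI r \<eta> by (auto simp: mor_def)
  then show ?thesis using subcategoryD(5)[OF sub B] morD(1)[OF \<eta>] by blast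
qed

text \<open>The section \<open>i\<close> extends over the reflection because its target is in
  \<open>X\<close>; following the extension by \<open>p\<close> gives the retraction.\<close>

lemma reflective_retract:
  assumes R: "reflective C X" and "S \<in> Obj X" and i: "mor C A S i" and p: "mor C S A p"
    and pi: "p \<cdot> i = Ident C A"
  shows "A \<in> Obj X"
proof -
  obtain B \<eta> where refl: "is_reflection C (Obj X) A B \<eta>" using reflectiveD[OF R morD(1)[OF i]] by blast
  then obtain i' where i': "mor C B S i'" "i' \<cdot> \<eta> = i" and \<eta>: "mor C A B \<eta>"
    using assms(2) i unfolding is_reflection_def by blast
  show ?thesis
    using reflection_split[OF _ refl mor_comp[OF i'(1) p]] R assoc[OF \<eta> i'(1) p] i' pi
    by (simp add: reflective_def)
qed

text \<open>The two projections extend separately over the reflection of \<open>S\<close>, and the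
  injections reassemble the extensions into a retraction.\<close>

lemma reflective_biproduct:
  assumes R: "reflective C X" and A: "A \<in> Obj X" and B: "B \<in> Obj X" and bip: "is_biproduct C A B S"
  shows "S \<in> Obj X"
proof -
  obtain i j p q where i: "mor C A S i" and j: "mor C B S j" and p: "mor C S A p" and q: "mor C S B q"
    and id: "(i \<cdot> p) \<otimes>\<^bsub>HomGrp C S S\<^esub> (j \<cdot> q) = Ident C S"
    using is_biproductE[OF bip] by metis
  obtain D \<eta> where refl: "is_reflection C (Obj X) S D \<eta>" using reflectiveD[OF R morD(1)[OF p]] by blast
  then obtain p' q' where p': "mor C D A p'" "p' \<cdot> \<eta> = p" and q': "mor C D B q'" "q' \<cdot> \<eta> = q"
    and \<eta>: "mor C S D \<eta>"
    using A B p q unfolding is_reflection_def by metis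
  note ip = mor_comp[OF p'(1) i] and jq = mor_comp[OF q'(1) j]
  have "(i \<cdot> p' \<otimes>\<^bsub>HomGrp C D S\<^esub> (j \<cdot> q')) \<cdot> \<eta> = Ident C S"
    using add_comp[OF \<eta> ip jq] assoc[OF \<eta> p'(1) i] assoc[OF \<eta> q'(1) j] p' q' id by simp
  then show ?thesis
    using reflection_split[OF _ refl mor_add[OF ip jq]] R by (simp add: reflective_def)
qed

text \<open>The zero morphism back from the reflection is already a retraction. The case of interest
  is an object of \<open>P\<close>, which vanishes in the stable category.\<close>

lemma reflective_zero:
  assumes R: "reflective C X" and A: "A \<in> Obj C" and z: "Ident C A = zero_mor C A A"
  shows "A \<in> Obj X"
proof -
  obtain B \<eta> where refl: "is_reflection C (Obj X) A B \<eta>" using reflectiveD[OF R A] by blast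
  then have \<eta>: "mor C A B \<eta>" by (simp add: is_reflection_def)
  show ?thesis using reflection_split[OF _ refl mor_zero[OF morD(2)[OF \<eta>] A]] R
      zero_comp[OF \<eta> A] z by (simp add: reflective_def)
qed

lemma reflective_weak_kernel:
  assumes R: "reflective C X" and A: "A \<in> Obj X" and B: "B \<in> Obj X"
    and k: "is_weak_kernel C A B f K k"
    and \<delta>: "is_weak_kernel C K A k D \<delta>" and D: "D \<in> Obj X"
  shows "K \<in> Obj X"
proof -
  have f: "mor C A B f" and mk: "mor C K A k" and fk: "f \<cdot> k = zero_mor C K B"
    using k by (auto simp: is_weak_kernel_def)
  have md: "mor C D K \<delta>" using \<delta> by (simp add: is_weak_kernel_def)
  have K: "K \<in> Obj C" using morD mk by blast
  obtain E \<eta> where refl: "is_reflection C (Obj X) K E \<eta>" using reflectiveD[OF R K] by blast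
  then have \<eta>: "mor C K E \<eta>" and E: "E \<in> Obj C" using morD by (auto simp: is_reflection_def)
  obtain k' where k': "mor C E A k'" "k' \<cdot> \<eta> = k" using refl A mk unfolding is_reflection_def by blast
  have "f \<cdot> k' \<cdot> \<eta> = zero_mor C E B \<cdot> \<eta>"
    using assoc[OF \<eta> k'(1) f] k' fk zero_comp[OF \<eta>] morD(2)[OF f] by simp
  \<comment> \<open>Here the uniqueness half of the reflection is used, which applies because
    \<open>B\<close> is in \<open>X\<close>. Without it the extension \<open>k'\<close> could not be
    lifted back to \<open>K\<close>.\<close>
  then have "f \<cdot> k' = zero_mor C E B"
    using refl B mor_comp[OF k'(1) f] mor_zero[OF E] morD(2)[OF f] mor_comp[OF \<eta>]
    unfolding is_reflection_def by metis
  then obtain r where r: "mor C E K r" "k \<cdot> r = k'" using k k' unfolding is_weak_kernel_def by blast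
  have "k \<cdot> Ident C K = k \<cdot> (r \<cdot> \<eta>)" using assoc[OF \<eta> r(1) mk] r k' id_right[OF mk] by simp
  then obtain \<psi> where \<psi>: "mor C K D \<psi>"
      "Ident C K = r \<cdot> \<eta> \<otimes>\<^bsub>HomGrp C K K\<^esub> (\<delta> \<cdot> \<psi>)"
    using weak_kernel_diff[OF \<delta> mor_ident[OF K] mor_comp[OF \<eta> r(1)]] by blast
  obtain \<psi>' where \<psi>': "mor C E D \<psi>'" "\<psi>' \<cdot> \<eta> = \<psi>" using refl D \<psi> unfolding is_reflection_def by blast
  note dp = mor_comp[OF \<psi>'(1) md]
  have "(r \<otimes>\<^bsub>HomGrp C E K\<^esub> (\<delta> \<cdot> \<psi>')) \<cdot> \<eta> = Ident C K"
    using add_comp[OF \<eta> r(1) dp] assoc[OF \<eta> \<psi>'(1) md] \<psi>' \<psi> by simp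
  then show ?thesis using reflection_split[OF _ refl mor_add[OF r(1) dp]] R by (simp add: reflective_def)
qed

end

section \<open>Opposite categories\<close>

definition opp :: "('o, 'm) cat \<Rightarrow> ('o, 'm) cat" where
  "opp C = \<lparr>Obj = Obj C, HomGrp = (\<lambda>A B. HomGrp C B A), Ident = Ident C, Comp = (\<lambda>g f. f \<cdot>\<^bsub>C\<^esub> g)\<rparr>"

lemma opp_simps [simp]:
  "Obj (opp C) = Obj C" "HomGrp (opp C) A B = HomGrp C B A"
  "Ident (opp C) = Ident C" "Comp (opp C) g f = f \<cdot>\<^bsub>C\<^esub> g"
  by (simp_all add: opp_def)

text \<open>Being an equation of records, it lets one implication, applied also to
  \<open>opp C\<close>, yield the converse.\<close>

lemma opp_opp [simp]: "opp (opp C) = C"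
  by (simp add: opp_def)

lemma opp_eq_iff: "opp C = opp D \<longleftrightarrow> C = D"
  by (metis opp_opp)

lemma opp_full_on: "opp (full_on C S) = full_on (opp C) S"
  by (simp add: opp_def full_on_def)

lemma mor_opp [simp]: "mor (opp C) A B f \<longleftrightarrow> mor C B A f"
  by (auto simp: mor_def)

lemma isomorphic_opp: "isomorphic (opp C) A B \<longleftrightarrow> isomorphic C A B"
  by (auto simp: isomorphic_def)

lemma is_zero_object_opp: "is_zero_object (opp C) Z \<longleftrightarrow> is_zero_object C Z"
  by (auto simp: is_zero_object_def)

lemma is_biproduct_oppI: "is_biproduct C A B S \<Longrightarrow> is_biproduct (opp C) A B S"
  unfolding is_biproduct_def by simp blast

lemma is_biproduct_opp: "is_biproduct (opp C) A B S \<longleftrightarrow> is_biproduct C A B S"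
  using is_biproduct_oppI[of C A B S] is_biproduct_oppI[of "opp C" A B S] by auto

lemma is_kernel_opp: "is_kernel (opp C) A B f K k \<longleftrightarrow> is_cokernel C B A f K k"
  by (auto simp: is_kernel_def is_cokernel_def)

lemma is_cokernel_opp: "is_cokernel (opp C) A B f Q c \<longleftrightarrow> is_kernel C B A f Q c"
  by (auto simp: is_kernel_def is_cokernel_def)

lemma is_mono_opp: "is_mono (opp C) A B f \<longleftrightarrow> is_epi C B A f"
  by (auto simp: is_mono_def is_epi_def)

lemma is_epi_opp: "is_epi (opp C) A B f \<longleftrightarrow> is_mono C B A f"
  by (auto simp: is_mono_def is_epi_def)

lemma is_weak_kernel_opp: "is_weak_kernel (opp C) A B f K k \<longleftrightarrow> is_weak_cokernel C B A f K k"
  by (auto simp: is_weak_kernel_def is_weak_cokernel_def)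

lemma preadditive_category_opp:
  assumes "preadditive_category C"
  shows "preadditive_category (opp C)"
proof -
  interpret preadditive_category C by fact
  show ?thesis
  proof (rule preadditive_category.intro, goal_cases)
    case (1 A B A' B' f) then show ?case using hom_disjoint[of B A B' A' f] by simp
  next
    case (2 A) then show ?case by (simp add: ident_closed)
  next
    case (3 A B D f g) then show ?case using comp_closed[of D B A g f] by simp
  next
    case (4 A B f) then show ?case using ident_comp[of B A f] by simp
  next
    case (5 A B f) then show ?case using comp_ident[of B A f] by simp
  next
    case (6 A B D E f g h) then show ?case using comp_assoc[of E D B A h g f] by simp
  next
    case (7 A B) then show ?case using hom_comm_group[of B A] by simp
  next
    case (8 A B D g) then show ?case using comp_additive_left[of D B A g] by simp
  next
    case (9 A B D f) then show ?case using comp_additive_right[of D B A f] by simp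
  qed
qed

lemma additive_category_opp:
  assumes "additive_category C"
  shows "additive_category (opp C)"
proof -
  interpret additive_category C by fact
  interpret opp: preadditive_category "opp C"
    by (rule preadditive_category_opp) unfold_locales
  show ?thesis
    by unfold_locales (use zero_object_exists biproduct_exists in
      \<open>auto simp: is_zero_object_opp is_biproduct_opp\<close>)
qed

lemma additive_category_opp_iff: "additive_category (opp C) \<longleftrightarrow> additive_category C"
  using additive_category_opp[of C] additive_category_opp[of "opp C"] by auto

lemma abelian_category_opp:
  assumes "abelian_category C"
  shows "abelian_category (opp C)"
proof -
  interpret abelian_category C by fact
  interpret opp: additive_category "opp C"
    by (rule additive_category_opp) unfold_locales
  show ?thesis
    by unfold_locales (use kernel_exists cokernel_exists mono_is_kernel epi_is_cokernel in
      \<open>auto simp: is_kernel_opp is_cokernel_opp is_mono_opp is_epi_opp\<close>)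
qed

lemma subcategory_opp: "subcategory (opp C) (opp X) \<longleftrightarrow> subcategory C X"
proof -
  have "opp X = full_on (opp C) (Obj X) \<longleftrightarrow> X = full_on C (Obj X)"
    by (simp only: opp_eq_iff flip: opp_full_on)
  then show ?thesis by (auto simp: subcategory_def isomorphic_opp)
qed

lemma additive_subcategory_opp: "additive_subcategory (opp C) (opp X) \<longleftrightarrow> additive_subcategory C X"
  by (simp add: additive_subcategory_def subcategory_opp additive_category_opp_iff)

lemma closed_under_summands_opp: "closed_under_summands (opp C) (opp X) \<longleftrightarrow> closed_under_summands C X"
  by (simp add: closed_under_summands_def is_biproduct_opp)

lemma rel_epi_opp: "rel_epi (opp C) X A B f \<longleftrightarrow> rel_mono C X B A f"
  by (auto simp: rel_epi_def rel_mono_def)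

lemma rel_mono_opp: "rel_mono (opp C) X A B f \<longleftrightarrow> rel_epi C X B A f"
  by (auto simp: rel_epi_def rel_mono_def)

lemma is_precover_opp: "is_precover (opp C) = is_preenvelope C"
  by (intro ext) (simp add: is_precover_def is_preenvelope_def rel_epi_opp)

lemma is_preenvelope_opp: "is_preenvelope (opp C) = is_precover C"
  by (intro ext) (simp add: is_precover_def is_preenvelope_def rel_mono_opp)

lemma precovering_opp: "precovering (opp C) (opp X) \<longleftrightarrow> preenveloping C X"
  by (simp add: precovering_def preenveloping_def is_precover_opp)

lemma preenveloping_opp: "preenveloping (opp C) (opp X) \<longleftrightarrow> precovering C X"
  by (simp add: precovering_def preenveloping_def is_preenvelope_opp)

lemma weakly_resolving_opp: "weakly_resolving (opp C) (opp P) (opp X) \<longleftrightarrow> weakly_coresolving C P X"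
  unfolding weakly_resolving_def weakly_coresolving_def
  by (simp add: additive_subcategory_opp is_precover_opp rel_epi_opp is_kernel_opp) blast

lemma split_idempotents_opp:
  assumes "split_idempotents C"
  shows "split_idempotents (opp C)"
  unfolding split_idempotents_def
proof (intro ballI impI)
  fix A e assume "A \<in> Obj (opp C)" "e \<in> Hom (opp C) A A" "e \<cdot>\<^bsub>opp C\<^esub> e = e"
  then have "\<exists>B \<in> Obj C. \<exists>p \<in> Hom C A B. \<exists>i \<in> Hom C B A. e = i \<cdot>\<^bsub>C\<^esub> p \<and> p \<cdot>\<^bsub>C\<^esub> i = Ident C B"
    using assms by (simp add: split_idempotents_def)
  then show "\<exists>B \<in> Obj (opp C). \<exists>p \<in> Hom (opp C) A B. \<exists>i \<in> Hom (opp C) B A.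
      e = i \<cdot>\<^bsub>opp C\<^esub> p \<and> p \<cdot>\<^bsub>opp C\<^esub> i = Ident (opp C) B"
    by simp blast
qed

section \<open>Full subcategories, adjunctions and stable quotients under duality\<close>

lemma is_biproduct_subcategory:
  assumes "subcategory C X" "A \<in> Obj X" "B \<in> Obj X" "S \<in> Obj X"
  shows "is_biproduct X A B S \<longleftrightarrow> is_biproduct C A B S"
  using assms(2-4) subsetD[OF subcategoryD(1)[OF assms(1)]]
  by (simp add: is_biproduct_def subcategoryD(2-4)[OF assms(1)])

text \<open>Additivity of \<open>X\<close> speaks of biproducts formed inside \<open>X\<close>;
  fullness makes them biproducts of \<open>C\<close>.\<close>

lemma additive_subcategory_biproduct:
  assumes X: "additive_subcategory C X" and A: "A \<in> Obj X" and B: "B \<in> Obj X"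
  obtains S where "S \<in> Obj X" "is_biproduct C A B S"
proof -
  have sub: "subcategory C X" using X by (simp add: additive_subcategory_def)
  interpret additive_category X using X by (simp add: additive_subcategory_def)
  obtain S where S: "is_biproduct X A B S" using biproduct_exists[OF A B] by blast
  then have "S \<in> Obj X" by (simp add: is_biproduct_def)
  then show thesis using that S is_biproduct_subcategory[OF sub A B] by blast
qed

lemma is_functor_opp: "is_functor (opp C) (opp D) F \<longleftrightarrow> is_functor C D F"
  by (auto simp: is_functor_def)

lemma adjoint_opp:
  assumes "preadditive_category C" "preadditive_category D" "adjoint C D L R"
  shows "adjoint (opp D) (opp C) R L"
proof -
  interpret C: preadditive_category C by fact
  interpret D: preadditive_category D by fact
  obtain \<phi> where L: "is_functor C D L" and R: "is_functor D C R"
    and bij: "\<And>A B. \<lbrakk>A \<in> Obj C; B \<in> Obj D\<rbrakk> \<Longrightarrow>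
      bij_betw (\<phi> A B) (Hom D (FObj L A) B) (Hom C A (FObj R B))"
    and nat: "\<And>A A' B B' a b h. \<lbrakk>A \<in> Obj C; A' \<in> Obj C; B \<in> Obj D; B' \<in> Obj D;
       a \<in> Hom C A' A; b \<in> Hom D B B'; h \<in> Hom D (FObj L A) B\<rbrakk> \<Longrightarrow>
       \<phi> A' B' (b \<cdot>\<^bsub>D\<^esub> h \<cdot>\<^bsub>D\<^esub> FMap L a) = FMap R b \<cdot>\<^bsub>C\<^esub> \<phi> A B h \<cdot>\<^bsub>C\<^esub> a"
    using assms(3) unfolding adjoint_def by blast
  \<comment> \<open>The adjoints exchange roles in the opposite category, so the bijection has to
    run backwards. Its naturality is that of \<open>\<phi>\<close> read through injectivity;
    associativity enters because reversing composition rebrackets triple composites.\<close>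
  let ?\<psi> = "\<lambda>B A. inv_into (Hom D (FObj L A) B) (\<phi> A B)"
  have "?\<psi> B' A' (a \<cdot>\<^bsub>opp C\<^esub> h \<cdot>\<^bsub>opp C\<^esub> FMap R b) = FMap L a \<cdot>\<^bsub>opp D\<^esub> ?\<psi> B A h \<cdot>\<^bsub>opp D\<^esub> b"
    if A: "A \<in> Obj C" "A' \<in> Obj C" and B: "B \<in> Obj D" "B' \<in> Obj D"
      and a: "a \<in> Hom C A' A" and b: "b \<in> Hom D B B'" and h: "h \<in> Hom C A (FObj R B)"
    for A A' B B' a b h
  proof -
    let ?g = "?\<psi> B A h"
    have inj: "inj_on (\<phi> A' B') (Hom D (FObj L A') B')" using bij[OF A(2) B(2)] by (simp add: bij_betw_def)
    have g: "?g \<in> Hom D (FObj L A) B" "\<phi> A B ?g = h"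
      using bij[OF A(1) B(1)] h by (auto simp: bij_betw_def inv_into_into f_inv_into_f)
    have La: "FMap L a \<in> Hom D (FObj L A') (FObj L A)" and LA: "FObj L A \<in> Obj D" "FObj L A' \<in> Obj D"
      and Rb: "FMap R b \<in> Hom C (FObj R B) (FObj R B')" and RB: "FObj R B \<in> Obj C" "FObj R B' \<in> Obj C"
      using L R A B a b by (auto simp: is_functor_def)
    have m: "b \<cdot>\<^bsub>D\<^esub> ?g \<cdot>\<^bsub>D\<^esub> FMap L a \<in> Hom D (FObj L A') B'"
      using D.comp_closed B LA La b g by metis
    have "FMap R b \<cdot>\<^bsub>C\<^esub> (h \<cdot>\<^bsub>C\<^esub> a) = FMap R b \<cdot>\<^bsub>C\<^esub> h \<cdot>\<^bsub>C\<^esub> a"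
      by (rule C.comp_assoc[OF A(2,1) RB a h Rb])
    also have "\<dots> = \<phi> A' B' (b \<cdot>\<^bsub>D\<^esub> ?g \<cdot>\<^bsub>D\<^esub> FMap L a)"
      using nat[OF A B a b g(1)] g(2) by simp
    finally have "?\<psi> B' A' (FMap R b \<cdot>\<^bsub>C\<^esub> (h \<cdot>\<^bsub>C\<^esub> a)) = b \<cdot>\<^bsub>D\<^esub> ?g \<cdot>\<^bsub>D\<^esub> FMap L a"
      using inv_into_f_f[OF inj m] by simp
    then show ?thesis using D.comp_assoc[OF LA(2,1) B La g(1) b] by simp
  qed
  moreover have "bij_betw (?\<psi> B A) (Hom C A (FObj R B)) (Hom D (FObj L A) B)"
    if "A \<in> Obj C" "B \<in> Obj D" for A B
    using bij_betw_inv_into[OF bij[OF that]] .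
  ultimately show ?thesis
    unfolding adjoint_def using L R
    by (intro conjI exI[of _ ?\<psi>]) (simp_all add: is_functor_opp)
qed

lemma preadditive_full_on:
  assumes "preadditive_category C" "S \<subseteq> Obj C"
  shows "preadditive_category (full_on C S)"
proof -
  interpret preadditive_category C by fact
  note S = subsetD[OF assms(2)]
  show ?thesis
  proof (rule preadditive_category.intro, goal_cases)
    case (1 A B A' B' f) then show ?case using hom_disjoint[of A B A' B' f] S by simp
  next
    case (2 A) then show ?case by (simp add: ident_closed S)
  next
    case (3 A B D f g) then show ?case using comp_closed[of A B D f g] S by simp
  next
    case (4 A B f) then show ?case using comp_ident[of A B f] S by simp
  next
    case (5 A B f) then show ?case using ident_comp[of A B f] S by simp
  next
    case (6 A B D E f g h) then show ?case using comp_assoc[of A B D E f g h] S by simp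
  next
    case (7 A B) then show ?case using hom_comm_group[of A B] S by simp
  next
    case (8 A B D g) then show ?case using comp_additive_right[of A B D g] S by simp
  next
    case (9 A B D f) then show ?case using comp_additive_left[of A B D f] S by simp
  qed
qed

lemma coreflective_iff:
  assumes C: "preadditive_category C"
  shows "coreflective C X \<longleftrightarrow> reflective (opp C) (opp X)"
proof -
  have "adjoint X C inclusion R \<longleftrightarrow> adjoint (opp C) (opp X) R inclusion"
    if X: "subcategory C X" for R
  proof -
    have pX: "preadditive_category X"
      using preadditive_full_on[OF C, of "Obj X"] X[unfolded subcategory_def] by (elim conjE) (erule ssubst)
    show ?thesis
      using adjoint_opp[OF pX C] adjoint_opp[OF preadditive_category_opp[OF C] preadditive_category_opp[OF pX]]
      by auto
  qed
  then show ?thesis by (auto simp: reflective_def coreflective_def subcategory_opp)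
qed

lemma factoring_opp: "factoring (opp C) (opp P) A B = factoring C P B A"
  by (auto simp: factoring_def)

lemma stable_class_opp: "stable_class (opp C) (opp P) A B f = stable_class C P B A f"
  by (simp add: stable_class_def factoring_opp)

text \<open>Even for classes that are not composable, the union defining composition ranges over the
  same composites, with \<open>F\<close> and \<open>G\<close> exchanged. Hence this is an equality
  and not merely an isomorphism.\<close>

lemma stable_opp: "stable (opp C) (opp P) = opp (stable C P)"
proof -
  have "{stable_class C P D A (f \<cdot>\<^bsub>C\<^esub> g) | A B D f g. A \<in> Obj C \<and> B \<in> Obj C \<and> D \<in> Obj C \<and>
          f \<in> F \<and> f \<in> Hom C B A \<and> g \<in> G \<and> g \<in> Hom C D B} =
        {stable_class C P A D (g \<cdot>\<^bsub>C\<^esub> f) | A B D f g. A \<in> Obj C \<and> B \<in> Obj C \<and> D \<in> Obj C \<and>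
          f \<in> G \<and> f \<in> Hom C A B \<and> g \<in> F \<and> g \<in> Hom C B D}" for F G
    by blast
  then show ?thesis
    unfolding stable_def by (simp add: factoring_opp stable_class_opp) (simp add: opp_def)
qed

lemma stable_sub_opp: "stable_sub (opp C) (opp P) (opp X) = opp (stable_sub C P X)"
  by (simp add: stable_sub_def stable_opp opp_full_on)

text \<open>Under duality both choice operators are applied to the same predicate, so they select
  the same objects.\<close>

lemma FObj_loop_opp: "FObj (loop_functor (opp C) (opp P)) = FObj (suspension_functor C P)"
  by (simp add: loop_functor_def suspension_functor_def loop_choice_def suspension_choice_def
      is_precover_opp is_kernel_opp)

section \<open>The stable category\<close>

locale stable_category = preadditive_category +
  fixes P :: "('o, 'm) cat"
  assumes additive_P: "additive_subcategory C P"
begin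

abbreviation St where "St \<equiv> stable C P"
abbreviation cls where "cls \<equiv> stable_class C P"

lemma sub_P: "subcategory C P" using additive_P by (simp add: additive_subcategory_def)

lemma P_Obj: "Q \<in> Obj P \<Longrightarrow> Q \<in> Obj C"
  using subcategoryD(1)[OF sub_P] by blast

section \<open>The ideal of morphisms factoring through \<open>P\<close> and its cosets\<close>

lemma factoringI:
  "\<lbrakk>Q \<in> Obj P; mor C A Q u; mor C Q B v\<rbrakk> \<Longrightarrow> v \<cdot> u \<in> factoring C P A B"
  using mor_comp[of A Q u B v] unfolding factoring_def mor_def by blast

lemma factoringE:
  assumes "h \<in> factoring C P A B" "A \<in> Obj C" "B \<in> Obj C"
  obtains Q u v where "Q \<in> Obj P" "mor C A Q u" "mor C Q B v" "h = v \<cdot> u"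
  using assms P_Obj unfolding factoring_def mor_def by blast

lemma zero_in_factoring:
  assumes "A \<in> Obj C" "B \<in> Obj C" shows "zero_mor C A B \<in> factoring C P A B"
proof -
  interpret P: additive_category P using additive_P by (simp add: additive_subcategory_def)
  obtain Z where "is_zero_object P Z" using P.zero_object_exists by blast
  then have Z: "Z \<in> Obj P" by (simp add: is_zero_object_def)
  have "zero_mor C Z B \<cdot> zero_mor C A Z \<in> factoring C P A B"
    by (rule factoringI[OF Z]) (use P_Obj Z assms mor_zero in auto)
  then show ?thesis using zero_comp[OF mor_zero[of A Z] assms(2)] assms P_Obj[OF Z] by simp
qed

text \<open>The point is closure under addition: a sum of morphisms through \<open>Q\<close> and
  \<open>Q'\<close> passes through their biproduct, which can be taken in \<open>P\<close>.\<close>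

lemma subgroup_factoring:
  assumes A: "A \<in> Obj C" and B: "B \<in> Obj C"
  shows "subgroup (factoring C P A B) (HomGrp C A B)"
proof (rule group.subgroupI[OF hom_group[OF A B]])
  show "factoring C P A B \<subseteq> Hom C A B" by (auto simp: factoring_def)
  show "factoring C P A B \<noteq> {}" using zero_in_factoring[OF A B] by blast
next
  fix h assume "h \<in> factoring C P A B"
  then obtain Q u v where Q: "Q \<in> Obj P" "mor C A Q u" "mor C Q B v" "h = v \<cdot> u"
    using factoringE[OF _ A B] by blast
  then show "inv\<^bsub>HomGrp C A B\<^esub> h \<in> factoring C P A B"
    using factoringI[OF Q(1,2) mor_neg[OF Q(3)]] neg_comp[OF Q(2,3)] by simp
next
  fix h h' assume "h \<in> factoring C P A B" "h' \<in> factoring C P A B"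
  then obtain Q u v Q' u' v' where Q: "Q \<in> Obj P" and u: "mor C A Q u" and v: "mor C Q B v"
    and h: "h = v \<cdot> u" and Q': "Q' \<in> Obj P" and u': "mor C A Q' u'" and v': "mor C Q' B v'"
    and h': "h' = v' \<cdot> u'"
    using factoringE[OF _ A B] by metis
  obtain S where S: "S \<in> Obj P" "is_biproduct C Q Q' S"
    using additive_subcategory_biproduct[OF additive_P Q Q'] .
  obtain a b where "mor C A S a" "mor C S B b" "b \<cdot> a = h \<otimes>\<^bsub>HomGrp C A B\<^esub> h'"
    using biproduct_factor[OF S(2) u v u' v'] h h' by metis
  then show "h \<otimes>\<^bsub>HomGrp C A B\<^esub> h' \<in> factoring C P A B"
    using factoringI[OF S(1), of A a B b] by simp
qed

lemma normal_factoring: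
  "\<lbrakk>A \<in> Obj C; B \<in> Obj C\<rbrakk> \<Longrightarrow> factoring C P A B \<lhd> HomGrp C A B"
  using subgroup_factoring hom_comm_group comm_group.subgroup_imp_normal by blast

lemma factoring_mor: "\<lbrakk>h \<in> factoring C P A B; A \<in> Obj C; B \<in> Obj C\<rbrakk> \<Longrightarrow> mor C A B h"
  by (simp add: factoring_def mor_def)

lemma mem_cls_iff: "f \<in> cls A B g \<longleftrightarrow> (\<exists>h \<in> factoring C P A B. f = h \<otimes>\<^bsub>HomGrp C A B\<^esub> g)"
  by (auto simp: stable_class_def r_coset_def)

lemma cls_mor: "\<lbrakk>f \<in> cls A B g; mor C A B g\<rbrakk> \<Longrightarrow> mor C A B f"
  using mem_cls_iff factoring_mor mor_add morD by metis

lemma cls_self: "mor C A B f \<Longrightarrow> f \<in> cls A B f"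
  unfolding stable_class_def mor_def using group.rcos_self[OF hom_group _ subgroup_factoring] by blast

lemma cls_eq_iff:
  assumes "mor C A B f" "mor C A B g"
  shows "cls A B f = cls A B g \<longleftrightarrow> (\<exists>h \<in> factoring C P A B. f = h \<otimes>\<^bsub>HomGrp C A B\<^esub> g)"
proof -
  have "cls A B f = cls A B g \<longleftrightarrow> f \<in> cls A B g"
    using group.repr_independence[OF hom_group, of A B f "factoring C P A B" g] cls_self[OF assms(1)]
      assms subgroup_factoring unfolding stable_class_def mor_def by blast
  then show ?thesis by (simp add: mem_cls_iff)
qed

lemma cls_eqI:
  "\<lbrakk>mor C A B g; h \<in> factoring C P A B; f = h \<otimes>\<^bsub>HomGrp C A B\<^esub> g\<rbrakk> \<Longrightarrow> cls A B f = cls A B g"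
  using cls_eq_iff mor_add factoring_mor morD by metis

lemma cls_zero: "\<lbrakk>A \<in> Obj C; B \<in> Obj C\<rbrakk> \<Longrightarrow> cls A B (zero_mor C A B) = factoring C P A B"
  unfolding stable_class_def
  using group.coset_mult_one[OF hom_group] subgroup.subset[OF subgroup_factoring] by blast

lemma stable_simps [simp]:
  "Obj St = Obj C" "Ident St A = cls A A (Ident C A)"
  "zero_mor St A B = factoring C P A B"
  by (simp_all add: stable_def)

lemma stable_mor_iff: "mor St A B F \<longleftrightarrow> (\<exists>f. mor C A B f \<and> F = cls A B f)"
  by (auto simp: mor_def stable_def carrier_FactGroup stable_class_def)

lemma mor_cls: "mor C A B f \<Longrightarrow> mor St A B (cls A B f)"
  using stable_mor_iff by blast

lemma cls_eq_zero_iff: "mor C A B f \<Longrightarrow> cls A B f = zero_mor St A B \<longleftrightarrow> f \<in> factoring C P A B"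
  using cls_eq_iff[OF _ mor_zero] cls_zero cls_self morD
  by (metis add_zero factoring_mor stable_simps(3))

lemma cls_add:
  assumes "mor C A B f" "mor C A B g"
  shows "cls A B f \<otimes>\<^bsub>HomGrp St A B\<^esub> cls A B g = cls A B (f \<otimes>\<^bsub>HomGrp C A B\<^esub> g)"
  using normal.rcos_sum[OF normal_factoring] assms
  by (simp add: stable_class_def stable_def mor_def)

section \<open>Composition in the stable category\<close>

lemma factoring_comp:
  assumes h: "h \<in> factoring C P A B" and A: "A \<in> Obj C" and g: "mor C B D g"
  shows "g \<cdot> h \<in> factoring C P A D"
proof -
  obtain Q u v where Q: "Q \<in> Obj P" "mor C A Q u" "mor C Q B v" "h = v \<cdot> u"
    using factoringE[OF h A morD(1)[OF g]] .
  then show ?thesis using factoringI[OF Q(1,2) mor_comp[OF Q(3) g]] assoc[OF Q(2,3) g] by simp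
qed

lemma comp_factoring:
  assumes f: "mor C A B f" and h: "h \<in> factoring C P B D" and D: "D \<in> Obj C"
  shows "h \<cdot> f \<in> factoring C P A D"
proof -
  obtain Q u v where Q: "Q \<in> Obj P" "mor C B Q u" "mor C Q D v" "h = v \<cdot> u"
    using factoringE[OF h morD(2)[OF f] D] .
  then show ?thesis using factoringI[OF Q(1) mor_comp[OF f Q(2)] Q(3)] assoc[OF f Q(2,3)] by simp
qed

text \<open>The union that defines composition collapses to one coset: the morphisms through
  \<open>P\<close> form a two-sided ideal, so representatives do not matter, and disjointness of
  hom-sets fixes the endpoints.\<close>

lemma cls_comp:
  assumes f: "mor C A B f" and g: "mor C B D g"
  shows "cls B D g \<cdot>\<^bsub>St\<^esub> cls A B f = cls A D (g \<cdot> f)"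
proof -
  have *: "cls A D (g' \<cdot> f') = cls A D (g \<cdot> f)" if f': "f' \<in> cls A B f" and g': "g' \<in> cls B D g" for f' g'
  proof -
    have mf': "mor C A B f'" and mg': "mor C B D g'" using cls_mor f f' g g' by blast+
    obtain a where a: "a \<in> factoring C P A B" "f' = a \<otimes>\<^bsub>HomGrp C A B\<^esub> f" using f' mem_cls_iff by blast
    obtain b where b: "b \<in> factoring C P B D" "g' = b \<otimes>\<^bsub>HomGrp C B D\<^esub> g" using g' mem_cls_iff by blast
    note ma = factoring_mor[OF a(1) morD(1,2)[OF f]] and mb = factoring_mor[OF b(1) morD(1,2)[OF g]]
    have "cls A D (g' \<cdot> f') = cls A D (g \<cdot> f')"
      by (rule cls_eqI[OF mor_comp[OF mf' g] comp_factoring[OF mf' b(1) morD(2)[OF g]]])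
        (simp add: add_comp[OF mf' mb g] b(2))
    also have "\<dots> = cls A D (g \<cdot> f)"
      by (rule cls_eqI[OF mor_comp[OF f g] factoring_comp[OF a(1) morD(1)[OF f] g]])
        (simp add: comp_add[OF ma f g] a(2))
    finally show ?thesis .
  qed
  have "{stable_class C P A' D' (g' \<cdot> f') | A' B' D' f' g'.
        A' \<in> Obj C \<and> B' \<in> Obj C \<and> D' \<in> Obj C \<and>
        f' \<in> cls A B f \<and> f' \<in> Hom C A' B' \<and> g' \<in> cls B D g \<and> g' \<in> Hom C B' D'} = {cls A D (g \<cdot> f)}"
    (is "?L = ?R")
  proof
    show "?L \<subseteq> ?R"
    proof
      fix x assume "x \<in> ?L"
      then obtain A' B' D' f' g' where x: "x = cls A' D' (g' \<cdot> f')" and f': "f' \<in> cls A B f" "mor C A' B' f'"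
        and g': "g' \<in> cls B D g" "mor C B' D' g'" unfolding mor_def by blast
      have "A' = A" "D' = D" using cls_mor f f' g g' mor_unique by metis+
      then show "x \<in> ?R" using x *[OF f'(1) g'(1)] by simp
    qed
    show "?R \<subseteq> ?L" using cls_self[OF f] cls_self[OF g] f g unfolding mor_def by blast
  qed
  then show ?thesis unfolding stable_def by simp
qed

lemma preadditive_stable: "preadditive_category St"
proof -
  have repr: "\<exists>f. mor C A B f \<and> F = cls A B f" if "A \<in> Obj St" "B \<in> Obj St" "F \<in> Hom St A B" for A B F
    using that stable_mor_iff[of A B F] by (simp add: mor_def)
  have closed: "cls A B f \<in> Hom St A B" if "mor C A B f" for A B f
    using mor_cls[OF that] by (simp add: mor_def)
  show ?thesis
  proof (rule preadditive_category.intro, goal_cases)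
    case (1 A B A' B' F)
    then obtain f f' where f: "mor C A B f" "F = cls A B f" "mor C A' B' f'" "F = cls A' B' f'"
      using repr by metis
    \<comment> \<open>The representative \<open>f\<close> also lies in the coset of
      \<open>f'\<close>, so it belongs to both hom-sets of \<open>C\<close>, whose endpoints must
      coincide.\<close>
    then show ?case using cls_self cls_mor mor_unique by metis
  next
    case (2 A) then show ?case using closed mor_ident by simp
  next
    case (3 A B D F G)
    then obtain f g where "mor C A B f" "F = cls A B f" "mor C B D g" "G = cls B D g" using repr by metis
    then show ?case using cls_comp closed mor_comp by simp
  next
    case (4 A B F)
    then obtain f where f: "mor C A B f" "F = cls A B f" using repr by metis
    then show ?case using cls_comp[OF mor_ident f(1)] id_right morD by simp
  next
    case (5 A B F)
    then obtain f where f: "mor C A B f" "F = cls A B f" using repr by metis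
    then show ?case using cls_comp[OF f(1) mor_ident] id_left morD by simp
  next
    case (6 A B D E F G H)
    then obtain f g h where f: "mor C A B f" "F = cls A B f" and g: "mor C B D g" "G = cls B D g"
      and h: "mor C D E h" "H = cls D E h" using repr by metis
    then show ?case
      by (simp add: cls_comp[OF f(1) g(1)] cls_comp[OF g(1) h(1)] cls_comp[OF mor_comp[OF f(1) g(1)] h(1)]
          cls_comp[OF f(1) mor_comp[OF g(1) h(1)]] assoc[OF f(1) g(1) h(1)])
  next
    case (7 A B)
    then show ?case using comm_group.abelian_FactGroup[OF hom_comm_group subgroup_factoring, of A B]
      by (simp add: stable_def)
  next
    case (8 A B D G)
    then obtain g where g: "mor C B D g" "G = cls B D g" using repr by metis
    have "G \<cdot>\<^bsub>St\<^esub> F \<in> Hom St A D \<and>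
      G \<cdot>\<^bsub>St\<^esub> (F \<otimes>\<^bsub>HomGrp St A B\<^esub> F') = (G \<cdot>\<^bsub>St\<^esub> F) \<otimes>\<^bsub>HomGrp St A D\<^esub> (G \<cdot>\<^bsub>St\<^esub> F')"
      if "F \<in> Hom St A B" "F' \<in> Hom St A B" for F F'
    proof -
      obtain f f' where f: "mor C A B f" "F = cls A B f" and f': "mor C A B f'" "F' = cls A B f'"
        using repr 8 \<open>F \<in> _\<close> \<open>F' \<in> _\<close> by metis
      show ?thesis unfolding f f' g
        by (simp add: cls_comp[OF f(1) g(1)] cls_comp[OF f'(1) g(1)] cls_add[OF f(1) f'(1)]
            cls_comp[OF mor_add[OF f(1) f'(1)] g(1)] cls_add[OF mor_comp[OF f(1) g(1)] mor_comp[OF f'(1) g(1)]]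
            comp_add[OF f(1) f'(1) g(1)] closed[OF mor_comp[OF f(1) g(1)]])
    qed
    then show ?case by (auto simp: hom_def)
  next
    case (9 A B D F)
    then obtain f where f: "mor C A B f" "F = cls A B f" using repr by metis
    have "G \<cdot>\<^bsub>St\<^esub> F \<in> Hom St A D \<and>
      (G \<otimes>\<^bsub>HomGrp St B D\<^esub> G') \<cdot>\<^bsub>St\<^esub> F = (G \<cdot>\<^bsub>St\<^esub> F) \<otimes>\<^bsub>HomGrp St A D\<^esub> (G' \<cdot>\<^bsub>St\<^esub> F)"
      if "G \<in> Hom St B D" "G' \<in> Hom St B D" for G G'
    proof -
      obtain g g' where g: "mor C B D g" "G = cls B D g" and g': "mor C B D g'" "G' = cls B D g'"
        using repr 9 \<open>G \<in> _\<close> \<open>G' \<in> _\<close> by metis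
      show ?thesis unfolding f g g'
        by (simp add: cls_comp[OF f(1) g(1)] cls_comp[OF f(1) g'(1)] cls_add[OF g(1) g'(1)]
            cls_comp[OF f(1) mor_add[OF g(1) g'(1)]] cls_add[OF mor_comp[OF f(1) g(1)] mor_comp[OF f(1) g'(1)]]
            add_comp[OF f(1) g(1) g'(1)] closed[OF mor_comp[OF f(1) g(1)]])
    qed
    then show ?case by (auto simp: hom_def)
  qed
qed

sublocale stable: preadditive_category St by (rule preadditive_stable)

section \<open>What descends from \<open>C\<close> to the stable category\<close>

lemma cls_comp_zero_iff:
  assumes "mor C A B f" "mor C B D g"
  shows "cls B D g \<cdot>\<^bsub>St\<^esub> cls A B f = zero_mor St A D \<longleftrightarrow> g \<cdot> f \<in> factoring C P A D"
  using cls_comp[OF assms] cls_eq_zero_iff[OF mor_comp[OF assms]] by simp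

lemma isomorphic_stable:
  assumes iso: "isomorphic C A B" and A: "A \<in> Obj C" and B: "B \<in> Obj C"
  shows "isomorphic St A B"
proof -
  obtain f g where f: "mor C A B f" and g: "mor C B A g" and eq: "g \<cdot> f = Ident C A" "f \<cdot> g = Ident C B"
    using assms unfolding isomorphic_def mor_def by blast
  show ?thesis
    by (rule stable.isomorphicI[of "cls A B f" _ _ "cls B A g"])
      (use stable.morD(3)[OF mor_cls[OF f]] stable.morD(3)[OF mor_cls[OF g]]
        cls_comp[OF f g] cls_comp[OF g f] eq in auto)
qed

lemma is_biproduct_stable:
  assumes "is_biproduct C A B S" shows "is_biproduct St A B S"
proof -
  obtain i j p q where i: "mor C A S i" and j: "mor C B S j" and p: "mor C S A p" and q: "mor C S B q"
    and eq: "p \<cdot> i = Ident C A" "q \<cdot> j = Ident C B" "q \<cdot> i = zero_mor C A B" "p \<cdot> j = zero_mor C B A"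
    and id: "(i \<cdot> p) \<otimes>\<^bsub>HomGrp C S S\<^esub> (j \<cdot> q) = Ident C S"
    using is_biproductE[OF assms] by metis
  have "cls A S i \<cdot>\<^bsub>St\<^esub> cls S A p \<otimes>\<^bsub>HomGrp St S S\<^esub> (cls B S j \<cdot>\<^bsub>St\<^esub> cls S B q) = Ident St S"
    using cls_comp[OF p i] cls_comp[OF q j] cls_add[OF mor_comp[OF p i] mor_comp[OF q j]] id by simp
  moreover have "cls S A p \<cdot>\<^bsub>St\<^esub> cls A S i = Ident St A" "cls S B q \<cdot>\<^bsub>St\<^esub> cls B S j = Ident St B"
    "cls S B q \<cdot>\<^bsub>St\<^esub> cls A S i = zero_mor St A B" "cls S A p \<cdot>\<^bsub>St\<^esub> cls B S j = zero_mor St B A"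
    using cls_comp[OF i p] cls_comp[OF j q] cls_comp[OF i q] cls_comp[OF j p] eq cls_zero morD i j by simp_all
  ultimately show ?thesis
    by (intro stable.is_biproductI[OF mor_cls[OF i] mor_cls[OF j] mor_cls[OF p] mor_cls[OF q]])
qed

text \<open>Only the existence of extensions is asked for, so extending a representative
  suffices.\<close>

lemma is_preenvelope_stable:
  assumes j: "is_preenvelope C X A T j" and X: "X \<subseteq> Obj C"
  shows "is_preenvelope St X A T (cls A T j)"
proof -
  have T: "T \<in> X" and mj: "mor C A T j" using j by (auto simp: is_preenvelope_iff)
  have "\<exists>G \<in> Hom St T Y. G \<cdot>\<^bsub>St\<^esub> cls A T j = F" if Y: "Y \<in> X" and F: "F \<in> Hom St A Y" for Y F
  proof -
    obtain f where f: "mor C A Y f" "F = cls A Y f"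
      using stable_mor_iff[of A Y F] F Y X morD[OF mj] by (auto simp: mor_def)
    obtain g where g: "mor C T Y g" "g \<cdot> j = f"
      using j f(1) Y X morD(2)[OF mj] unfolding is_preenvelope_iff mor_def by blast
    then show ?thesis using cls_comp[OF mj g(1)] f(2) stable.morD(3)[OF mor_cls[OF g(1)]] by auto
  qed
  moreover have "G \<cdot>\<^bsub>St\<^esub> cls A T j \<in> Hom St A Y" if Y: "Y \<in> X" and G: "G \<in> Hom St T Y" for Y G
  proof -
    have "mor St T Y G" using G Y X T by (auto simp: mor_def)
    then show ?thesis using stable.mor_comp[OF mor_cls[OF mj]] stable.morD(3) by blast
  qed
  ultimately show ?thesis using T mor_cls[OF mj] unfolding is_preenvelope_iff by blast
qed

lemma rel_epi_lift:
  assumes "rel_epi C X A B f" "T \<in> X" "mor C T B g"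
  obtains h where "mor C T A h" "f \<cdot> h = g"
proof -
  have "g \<in> (\<lambda>h. f \<cdot> h) ` Hom C T A" using assms by (simp add: rel_epi_def mor_def)
  then obtain h where "g = f \<cdot> h" "h \<in> Hom C T A" by (rule imageE)
  then show thesis using that assms by (simp add: rel_epi_def mor_def)
qed

text \<open>If \<open>f \<cdot> t\<close> is stably zero, it equals some \<open>v \<cdot> u\<close>
  through an object of \<open>P\<close>. A \<open>P\<close>-epimorphism lifts \<open>v\<close> to
  \<open>w\<close>; then \<open>t\<close> minus \<open>w \<cdot> u\<close> is killed by
  \<open>f\<close> in \<open>C\<close> and factors through \<open>k\<close>, while
  \<open>w \<cdot> u\<close> is stably zero.\<close>

lemma weak_kernel_stable:
  assumes f: "rel_epi C (Obj P) A B f" and k: "is_kernel C A B f K k"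
  shows "is_weak_kernel St A B (cls A B f) K (cls K A k)"
proof -
  have mf: "mor C A B f" and mk: "mor C K A k" and fk: "f \<cdot> k = zero_mor C K B"
    using is_kernelD[OF k] by auto
  have "\<exists>U. mor St T K U \<and> cls K A k \<cdot>\<^bsub>St\<^esub> U = F"
    if F: "mor St T A F" and z: "cls A B f \<cdot>\<^bsub>St\<^esub> F = zero_mor St T B" for T F
  proof -
    obtain t where t: "mor C T A t" "F = cls T A t" using F stable_mor_iff by blast
    then have "f \<cdot> t \<in> factoring C P T B" using cls_comp_zero_iff[OF t(1) mf] z by simp
    then obtain Q u v where Q: "Q \<in> Obj P" and u: "mor C T Q u" and v: "mor C Q B v" and eq: "f \<cdot> t = v \<cdot> u"
      using factoringE morD t(1) mf by metis
    obtain w where w: "mor C Q A w" "f \<cdot> w = v" using rel_epi_lift[OF f Q v] .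
    have "f \<cdot> t = f \<cdot> (w \<cdot> u)" using eq w assoc[OF u w(1) mf] by simp
    then obtain y where y: "mor C T K y" "t = w \<cdot> u \<otimes>\<^bsub>HomGrp C T A\<^esub> (k \<cdot> y)"
      using weak_kernel_diff[OF kernel_weak_kernel[OF k] t(1) mor_comp[OF u w(1)]] by blast
    have "F = cls T A (k \<cdot> y)"
      unfolding t(2) by (rule cls_eqI[OF mor_comp[OF y(1) mk] factoringI[OF Q u w(1)] y(2)])
    then show ?thesis using mor_cls[OF y(1)] cls_comp[OF y(1) mk] by auto
  qed
  moreover have "cls A B f \<cdot>\<^bsub>St\<^esub> cls K A k = zero_mor St K B"
    using cls_comp_zero_iff[OF mk mf] fk zero_in_factoring morD mk mf by metis
  ultimately show ?thesis using mor_cls mf mk unfolding is_weak_kernel_def by blast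
qed

text \<open>The map \<open>\<Omega> B \<rightarrow> K\<close> of the left triangle \<open>\<Omega> B \<rightarrow> K \<rightarrow> A \<rightarrow> B\<close>.\<close>

lemma loop_weak_kernel:
  assumes f: "rel_epi C (Obj P) A B f" and k: "is_kernel C A B f K k"
    and p: "is_precover C (Obj P) B Q p" and \<kappa>: "is_kernel C Q B p D \<kappa>"
  shows "\<exists>\<delta>. is_weak_kernel St K A (cls K A k) D \<delta>"
proof -
  have mf: "mor C A B f" and mk: "mor C K A k" and fk: "f \<cdot> k = zero_mor C K B"
    using is_kernelD[OF k] by auto
  have mp: "mor C Q B p" and m\<kappa>: "mor C D Q \<kappa>" and p\<kappa>: "p \<cdot> \<kappa> = zero_mor C D B"
    using is_kernelD[OF \<kappa>] by auto
  have Q: "Q \<in> Obj P" and ep: "rel_epi C (Obj P) Q B p" using p by (auto simp: is_precover_def)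
  \<comment> \<open>A comparison over \<open>B\<close> from the precover to \<open>f\<close>.
    Restricting it to the kernels gives \<open>\<delta>\<close>.\<close>
  obtain w where w: "mor C Q A w" "f \<cdot> w = p" using rel_epi_lift[OF f Q mp] .
  have "f \<cdot> (w \<cdot> \<kappa>) = zero_mor C D B" using assoc[OF m\<kappa> w(1) mf] w p\<kappa> by simp
  then obtain \<delta> where \<delta>: "mor C D K \<delta>" "k \<cdot> \<delta> = w \<cdot> \<kappa>"
    using is_kernelD(4)[OF k mor_comp[OF m\<kappa> w(1)]] by blast
  have "\<exists>U. mor St T D U \<and> cls D K \<delta> \<cdot>\<^bsub>St\<^esub> U = F"
    if F: "mor St T K F" and z: "cls K A k \<cdot>\<^bsub>St\<^esub> F = zero_mor St T A" for T F
  proof -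
    obtain t where t: "mor C T K t" "F = cls T K t" using F stable_mor_iff by blast
    then have "k \<cdot> t \<in> factoring C P T A" using cls_comp_zero_iff[OF t(1) mk] z by simp
    then obtain Q' u v where Q': "Q' \<in> Obj P" and u: "mor C T Q' u" and v: "mor C Q' A v"
      and eq: "k \<cdot> t = v \<cdot> u"
      using factoringE morD t(1) mk by metis
    \<comment> \<open>Now compare in the other direction, from \<open>v\<close> to the precover.
      Then \<open>v\<close> and \<open>w \<cdot> x\<close> agree after \<open>f\<close>, and their
      difference comes from \<open>K\<close>; composed with \<open>u\<close> it becomes a term
      through \<open>P\<close>.\<close>
    obtain x where x: "mor C Q' Q x" "p \<cdot> x = f \<cdot> v" using rel_epi_lift[OF ep Q' mor_comp[OF v mf]] .
    have "p \<cdot> (x \<cdot> u) = f \<cdot> k \<cdot> t"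
      using assoc[OF u x(1) mp] x assoc[OF u v mf] eq assoc[OF t(1) mk mf] by simp
    then have "p \<cdot> (x \<cdot> u) = zero_mor C T B" using fk zero_comp[OF t(1) morD(2)[OF mf]] by simp
    then obtain y where y: "mor C T D y" "\<kappa> \<cdot> y = x \<cdot> u"
      using is_kernelD(4)[OF \<kappa> mor_comp[OF u x(1)]] by blast
    have "f \<cdot> v = f \<cdot> (w \<cdot> x)" using x w assoc[OF x(1) w(1) mf] by simp
    then obtain z where z: "mor C Q' K z" "v = w \<cdot> x \<otimes>\<^bsub>HomGrp C Q' A\<^esub> (k \<cdot> z)"
      using weak_kernel_diff[OF kernel_weak_kernel[OF k] v mor_comp[OF x(1) w(1)]] by blast
    note dy = mor_comp[OF y(1) \<delta>(1)] and zu = mor_comp[OF u z(1)]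
    have "k \<cdot> t = w \<cdot> x \<cdot> u \<otimes>\<^bsub>HomGrp C T A\<^esub> (k \<cdot> z \<cdot> u)"
      using eq z(2) add_comp[OF u mor_comp[OF x(1) w(1)] mor_comp[OF z(1) mk]] by simp
    also have "w \<cdot> x \<cdot> u = k \<cdot> (\<delta> \<cdot> y)"
      using assoc[OF u x(1) w(1)] y assoc[OF y(1) m\<kappa> w(1)] \<delta> assoc[OF y(1) \<delta>(1) mk] by simp
    also have "k \<cdot> z \<cdot> u = k \<cdot> (z \<cdot> u)" by (rule assoc[OF u z(1) mk])
    also have "k \<cdot> (\<delta> \<cdot> y) \<otimes>\<^bsub>HomGrp C T A\<^esub> (k \<cdot> (z \<cdot> u)) = k \<cdot> (z \<cdot> u \<otimes>\<^bsub>HomGrp C T K\<^esub> (\<delta> \<cdot> y))"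
      using comp_add[OF zu dy mk] add_commute[OF mor_comp[OF dy mk] mor_comp[OF zu mk]] by simp
    \<comment> \<open>The monomorphism \<open>k\<close> is cancelled in \<open>C\<close>, where this
      is allowed. Stably the summand \<open>z \<cdot> u\<close> disappears and leaves the wanted
      lift \<open>y\<close>.\<close>
    finally have "t = z \<cdot> u \<otimes>\<^bsub>HomGrp C T K\<^esub> (\<delta> \<cdot> y)"
      using kernel_mono[OF k t(1) mor_add[OF zu dy]] by blast
    then have "F = cls T K (\<delta> \<cdot> y)"
      unfolding t(2) using cls_eqI[OF dy factoringI[OF Q' u z(1)]] by blast
    then show ?thesis using mor_cls[OF y(1)] cls_comp[OF y(1) \<delta>(1)] by auto
  qed
  moreover have "cls K A k \<cdot>\<^bsub>St\<^esub> cls D K \<delta> = zero_mor St D A"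
    using cls_comp_zero_iff[OF \<delta>(1) mk] \<delta>(2) factoringI[OF Q m\<kappa> w(1)] by simp
  ultimately show ?thesis using mor_cls[OF mk] mor_cls[OF \<delta>(1)] unfolding is_weak_kernel_def by blast
qed

end

text \<open>In the opposite category a cokernel of a \<open>P\<close>-monomorphism is a kernel of a
  \<open>P\<close>-epimorphism.\<close>

lemma (in stable_category) weak_cokernel_stable:
  assumes "rel_mono C (Obj P) A B f" and "is_cokernel C A B f K k"
  shows "is_weak_cokernel St A B (cls A B f) K (cls B K k)"
proof -
  interpret opp: stable_category "opp C" "opp P"
    using preadditive_category_opp preadditive_category_axioms additive_P
    by (simp add: stable_category_def stable_category_axioms_def additive_subcategory_opp)
  show ?thesis
    using opp.weak_kernel_stable[of B A f K k] assms
    by (simp add: rel_epi_opp is_kernel_opp stable_opp stable_class_opp is_weak_kernel_opp)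
qed

section \<open>Resolving and reflective subcategories\<close>

text \<open>The complement is the kernel of \<open>F\<close>: the identity minus
  \<open>G \<cdot> F\<close> is killed by \<open>F\<close>, so it factors as
  \<open>k \<cdot> q\<close>, and cancelling \<open>k\<close> gives the remaining equations. It
  bridges retracts, which the arguments produce, and biproduct summands, of which
  \<open>closed_under_summands\<close> speaks.\<close>

lemma (in abelian_category) retract_biproduct:
  assumes F: "mor C A B F" and G: "mor C B A G" and FG: "F \<cdot> G = Ident C B"
  shows "\<exists>K. is_biproduct C B K A"
proof -
  obtain K k where k: "is_kernel C A B F K k" using kernel_exists F unfolding mor_def by blast
  have mk: "mor C K A k" and Fk: "F \<cdot> k = zero_mor C K B" using is_kernelD[OF k] by auto
  have A: "A \<in> Obj C" and K: "K \<in> Obj C" and B: "B \<in> Obj C" using morD F mk by blast+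
  note GF = mor_comp[OF F G]
  have "F \<cdot> Ident C A = F \<cdot> (G \<cdot> F)" using assoc[OF F G F] FG id_left[OF F] id_right[OF F] by simp
  then obtain q where q: "mor C A K q" "Ident C A = G \<cdot> F \<otimes>\<^bsub>HomGrp C A A\<^esub> (k \<cdot> q)"
    using weak_kernel_diff[OF kernel_weak_kernel[OF k] mor_ident[OF A] GF] by blast
  note kq = mor_comp[OF q(1) mk]
  have "k = (G \<cdot> F \<otimes>\<^bsub>HomGrp C A A\<^esub> (k \<cdot> q)) \<cdot> k" using q(2) id_left[OF mk] by simp
  also have "\<dots> = G \<cdot> F \<cdot> k \<otimes>\<^bsub>HomGrp C K A\<^esub> (k \<cdot> q \<cdot> k)" by (rule add_comp[OF mk GF kq])
  also have "G \<cdot> F \<cdot> k = zero_mor C K A" using assoc[OF mk F G] Fk comp_zero[OF K G] by simp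
  also have "zero_mor C K A \<otimes>\<^bsub>HomGrp C K A\<^esub> (k \<cdot> q \<cdot> k) = k \<cdot> (q \<cdot> k)"
    using zero_add[OF mor_comp[OF mk kq]] assoc[OF mk q(1) mk] by simp
  finally have "k \<cdot> (q \<cdot> k) = k \<cdot> Ident C K" using id_right[OF mk] by simp
  then have qk: "q \<cdot> k = Ident C K"
    by (rule kernel_mono[OF k mor_comp[OF mk q(1)] mor_ident[OF K]])
  have "G = (G \<cdot> F \<otimes>\<^bsub>HomGrp C A A\<^esub> (k \<cdot> q)) \<cdot> G" using q(2) id_left[OF G] by simp
  also have "\<dots> = G \<cdot> F \<cdot> G \<otimes>\<^bsub>HomGrp C B A\<^esub> (k \<cdot> q \<cdot> G)" by (rule add_comp[OF G GF kq])
  also have "G \<cdot> F \<cdot> G = G" using assoc[OF G F G] FG id_right[OF G] by simp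
  finally have "k \<cdot> q \<cdot> G = zero_mor C B A" using add_eq_self[OF G mor_comp[OF G kq]] by simp
  then have "k \<cdot> (q \<cdot> G) = k \<cdot> zero_mor C B K" using assoc[OF G q(1) mk] comp_zero[OF B mk] by simp
  then have "q \<cdot> G = zero_mor C B K" by (rule kernel_mono[OF k mor_comp[OF G q(1)] mor_zero[OF B K]])
  then have "is_biproduct C B K A"
    using is_biproductI[OF G mk F q(1) FG qk _ Fk] q(2) by simp
  then show ?thesis by blast
qed

lemma full_on_subcategory: "subcategory C X \<Longrightarrow> X = full_on C (Obj X)"
  by (simp add: subcategory_def)

lemma additive_subcategory_full_onI:
  assumes C: "additive_category C" and sub: "subcategory C (full_on C S)"
    and Z: "is_zero_object C Z" "Z \<in> S"
    and bip: "\<And>A B T. \<lbrakk>A \<in> S; B \<in> S; is_biproduct C A B T\<rbrakk> \<Longrightarrow> T \<in> S"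
  shows "additive_subcategory C (full_on C S)"
proof -
  interpret additive_category C by fact
  have SC: "S \<subseteq> Obj C" using subcategoryD(1)[OF sub] by simp
  interpret X: preadditive_category "full_on C S"
    by (rule preadditive_full_on[OF _ SC]) unfold_locales
  have "is_zero_object (full_on C S) Z" using Z SC
    unfolding is_zero_object_def full_on_simps by blast
  moreover have "\<exists>T. is_biproduct (full_on C S) A B T" if AB: "A \<in> S" "B \<in> S" for A B
  proof -
    obtain T where T: "is_biproduct C A B T" using biproduct_exists AB SC by blast
    have "T \<in> S" using bip[OF AB T] .
    then show ?thesis using is_biproduct_subcategory[OF sub] AB T by auto
  qed
  ultimately have "additive_category (full_on C S)" by unfold_locales auto
  then show ?thesis using sub by (simp add: additive_subcategory_def)
qed

locale abelian_stable_category = abelian_category C + stable_category C P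
  for C :: "('o, 'm) cat" (structure) and P :: "('o, 'm) cat" +
  assumes precovering_P: "precovering C P"
    and preenveloping_P: "preenveloping C P"
begin

section \<open>From resolving to reflective subcategories\<close>

lemma Obj_stable_sub [simp]: "Obj (stable_sub C P X) = Obj X"
  by (simp add: stable_sub_def)

text \<open>Stably \<open>F\<close> splits; in \<open>C\<close> this says that the identity of
  \<open>B\<close> is \<open>f \<cdot> g\<close> plus a morphism through some \<open>Q\<close> in
  \<open>P\<close>. So \<open>B\<close> is an honest retract of the biproduct of \<open>Q\<close>
  and \<open>A\<close>, which lies in \<open>X\<close>.\<close>

lemma retract_stable:
  assumes X: "additive_subcategory C X" "Obj P \<subseteq> Obj X" "closed_under_summands C X" and A: "A \<in> Obj X"
    and F: "mor St A B F" and G: "mor St B A G" and FG: "F \<cdot>\<^bsub>St\<^esub> G = Ident St B"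
  shows "B \<in> Obj X"
proof -
  obtain f g where f: "mor C A B f" "F = cls A B f" and g: "mor C B A g" "G = cls B A g"
    using F G stable_mor_iff by metis
  have B: "B \<in> Obj C" using morD f by blast
  have "cls B B (Ident C B) = cls B B (f \<cdot> g)" using FG f g cls_comp[OF g(1) f(1)] by simp
  then obtain h where h: "h \<in> factoring C P B B" "Ident C B = h \<otimes>\<^bsub>HomGrp C B B\<^esub> (f \<cdot> g)"
    using cls_eq_iff[OF mor_ident[OF B] mor_comp[OF g(1) f(1)]] by blast
  obtain Q u v where Q: "Q \<in> Obj P" and u: "mor C B Q u" and v: "mor C Q B v" and hv: "h = v \<cdot> u"
    using factoringE[OF h(1) B B] .
  obtain S where S: "S \<in> Obj X" "is_biproduct C Q A S"
    using additive_subcategory_biproduct[OF X(1) _ A] X(2) Q by blast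
  obtain a b where "mor C B S a" "mor C S B b" "b \<cdot> a = v \<cdot> u \<otimes>\<^bsub>HomGrp C B B\<^esub> (f \<cdot> g)"
    using biproduct_factor[OF S(2) u v g(1) f(1)] .
  then obtain K where "is_biproduct C B K S" using retract_biproduct[of S B b a] h hv by auto
  then show ?thesis using X(3) S(1) unfolding closed_under_summands_def by blast
qed

text \<open>Adding to \<open>f\<close> a \<open>P\<close>-precover of its target does not change \<open>f\<close> stably and makes it a
  \<open>P\<close>-epimorphism.\<close>

lemma weak_kernel_in_resolving:
  assumes X: "weakly_resolving C P X" and A: "A \<in> Obj X" and B: "B \<in> Obj X" and f: "mor C A B f"
  obtains K k where "K \<in> Obj X" "is_weak_kernel St A B (cls A B f) K k"
proof -
  have add: "additive_subcategory C X" and PX: "Obj P \<subseteq> Obj X"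
    using X by (auto simp: weakly_resolving_def)
  have BC: "B \<in> Obj C" using morD f by blast
  obtain Q \<pi> where "is_precover C (Obj P) B Q \<pi>" using precovering_P BC unfolding precovering_def by blast
  then have Q: "Q \<in> Obj P" and \<pi>: "mor C Q B \<pi>" and ep: "rel_epi C (Obj P) Q B \<pi>"
    by (auto simp: is_precover_def rel_epi_def mor_def)
  obtain S where S: "S \<in> Obj X" "is_biproduct C A Q S"
    using additive_subcategory_biproduct[OF add A] PX Q by blast
  obtain i j p q where i: "mor C A S i" and j: "mor C Q S j" and p: "mor C S A p" and q: "mor C S Q q"
    and eq: "p \<cdot> i = Ident C A" "q \<cdot> j = Ident C Q" "q \<cdot> i = zero_mor C A Q" "p \<cdot> j = zero_mor C Q A"
    using is_biproductE[OF S(2)] by metis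
  note \<pi>q = mor_comp[OF q \<pi>] and fp = mor_comp[OF p f]
  \<comment> \<open>This is the row \<open>[\<pi>, f]\<close> on the biproduct of \<open>Q\<close>
    and \<open>A\<close>. The precover component makes it a \<open>P\<close>-epimorphism and,
    factoring through \<open>Q\<close>, leaves only \<open>f \<cdot> p\<close> stably.\<close>
  define \<Phi> where "\<Phi> = \<pi> \<cdot> q \<otimes>\<^bsub>HomGrp C S B\<^esub> (f \<cdot> p)"
  have \<Phi>: "mor C S B \<Phi>" unfolding \<Phi>_def by (rule mor_add[OF \<pi>q fp])
  have \<Phi>i: "\<Phi> \<cdot> i = f"
    unfolding \<Phi>_def using add_comp[OF i \<pi>q fp] assoc[OF i q \<pi>] assoc[OF i p f] eq
      comp_zero[OF morD(1)[OF f] \<pi>] id_right[OF f] zero_add[OF f] by simp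
  have \<Phi>j: "\<Phi> \<cdot> j = \<pi>"
    unfolding \<Phi>_def using add_comp[OF j \<pi>q fp] assoc[OF j q \<pi>] assoc[OF j p f] eq
      comp_zero[OF morD(1)[OF \<pi>] f] id_right[OF \<pi>] add_zero[OF \<pi>] by simp
  have cls_\<Phi>: "cls S B \<Phi> = cls A B f \<cdot>\<^bsub>St\<^esub> cls S A p"
    unfolding cls_comp[OF p f] using cls_eqI[OF fp factoringI[OF Q q \<pi>]] \<Phi>_def by blast
  have epi: "rel_epi C (Obj P) S B \<Phi>"
    unfolding rel_epi_def
  proof (intro conjI ballI subset_antisym subsetI)
    show "S \<in> Obj C" "B \<in> Obj C" "\<Phi> \<in> Hom C S B" using morD \<Phi> by auto
  next
    fix T x assume T: "T \<in> Obj P" "x \<in> (\<lambda>g. \<Phi> \<cdot> g) ` Hom C T S"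
    then obtain g where "mor C T S g" "x = \<Phi> \<cdot> g" using P_Obj morD(1)[OF \<Phi>] by (auto simp: mor_def)
    then show "x \<in> Hom C T B" using mor_comp[OF _ \<Phi>] morD(3) by blast
  next
    fix T g assume T: "T \<in> Obj P" "g \<in> Hom C T B"
    then have "mor C T B g" using P_Obj BC by (auto simp: mor_def)
    then obtain h where h: "mor C T Q h" "\<pi> \<cdot> h = g" using rel_epi_lift[OF ep T(1)] by blast
    have "g = \<Phi> \<cdot> (j \<cdot> h)" using assoc[OF h(1) j \<Phi>] \<Phi>j h(2) by simp
    then show "g \<in> (\<lambda>g. \<Phi> \<cdot> g) ` Hom C T S" using morD(3)[OF mor_comp[OF h(1) j]] by blast
  qed
  obtain K \<kappa> where \<kappa>: "is_kernel C S B \<Phi> K \<kappa>" using kernel_exists \<Phi> unfolding mor_def by blast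
  have K: "K \<in> Obj X" using X epi \<kappa> S(1) B unfolding weakly_resolving_def by blast
  note wk = weak_kernel_stable[OF epi \<kappa>]
  note m\<kappa> = is_kernelD(2)[OF \<kappa>]
  have scls: "mor St S A (cls S A p)" "mor St A B (cls A B f)" "mor St K S (cls K S \<kappa>)"
      "mor St S B (cls S B \<Phi>)" "mor St A S (cls A S i)"
    using mor_cls p f m\<kappa> \<Phi> i by auto
  \<comment> \<open>The weak kernel of \<open>\<Phi>\<close> is moved to \<open>A\<close> along
    \<open>p\<close>. Test morphisms into \<open>A\<close> are carried to \<open>S\<close> by
    \<open>i\<close>, and \<open>p \<cdot> i\<close> being the identity brings their lifts
    back.\<close>
  define k where "k = cls S A p \<cdot>\<^bsub>St\<^esub> cls K S \<kappa>"
  have k: "mor St K A k" unfolding k_def using stable.mor_comp scls by blast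
  have "cls A B f \<cdot>\<^bsub>St\<^esub> k = zero_mor St K B"
    using wk stable.assoc[OF scls(3,1,2)] cls_\<Phi> by (simp add: k_def is_weak_kernel_def)
  moreover have "\<exists>U. mor St T K U \<and> k \<cdot>\<^bsub>St\<^esub> U = t"
    if t: "mor St T A t" and z: "cls A B f \<cdot>\<^bsub>St\<^esub> t = zero_mor St T B" for T t
  proof -
    note it = stable.mor_comp[OF t scls(5)]
    have "cls S B \<Phi> \<cdot>\<^bsub>St\<^esub> (cls A S i \<cdot>\<^bsub>St\<^esub> t) = zero_mor St T B"
      using stable.assoc[OF t scls(5,4)] cls_comp[OF i \<Phi>] \<Phi>i z by simp
    then obtain U where U: "mor St T K U" "cls K S \<kappa> \<cdot>\<^bsub>St\<^esub> U = cls A S i \<cdot>\<^bsub>St\<^esub> t"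
      using wk it unfolding is_weak_kernel_def by blast
    have "k \<cdot>\<^bsub>St\<^esub> U = cls S A p \<cdot>\<^bsub>St\<^esub> (cls A S i \<cdot>\<^bsub>St\<^esub> t)"
      unfolding k_def using stable.assoc[OF U(1) scls(3,1)] U(2) by simp
    also have "\<dots> = t"
      using stable.assoc[OF t scls(5,1)] cls_comp[OF i p] eq(1) stable.id_left[OF t] by simp
    finally show ?thesis using U(1) by blast
  qed
  ultimately have "is_weak_kernel St A B (cls A B f) K k"
    using k scls unfolding is_weak_kernel_def by blast
  then show thesis using that K by blast
qed

lemma loop_choice_exists:
  assumes "A \<in> Obj C"
  obtains Q p \<kappa> where "is_precover C (Obj P) A Q p" "is_kernel C Q A p (FObj (loop_functor C P) A) \<kappa>"
proof -
  obtain Q p where p: "is_precover C (Obj P) A Q p" using precovering_P assms unfolding precovering_def by blast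
  then obtain K k where "is_kernel C Q A p K k"
    using kernel_exists unfolding is_precover_def rel_epi_def by blast
  then have "case (Q, p, K, k) of (Q, p, K, k) \<Rightarrow> is_precover C (Obj P) A Q p \<and> is_kernel C Q A p K k"
    using p by simp
  then have "case loop_choice C P A of (Q, p, K, k) \<Rightarrow> is_precover C (Obj P) A Q p \<and> is_kernel C Q A p K k"
    unfolding loop_choice_def by (rule someI)
  then show thesis using that by (auto simp: loop_functor_def split: prod.splits)
qed

lemma reflective_stable_sub:
  assumes split: "split_idempotents St" and X: "weakly_resolving C P X" and env: "preenveloping C X"
    and summands: "closed_under_summands C X"
  shows "reflective St (stable_sub C P X)"
proof (rule stable.reflectiveI)
  have add: "additive_subcategory C X" and PX: "Obj P \<subseteq> Obj X"
    using X by (auto simp: weakly_resolving_def)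
  then have XC: "Obj X \<subseteq> Obj C" using subcategoryD(1) by (auto simp: additive_subcategory_def)
  note retract = retract_stable[OF add PX summands]
  \<comment> \<open>\<open>X\<close> is given as closed under isomorphisms of \<open>C\<close>; a
    stable isomorphism is handled as a stable retraction, which is where closure under summands
    enters.\<close>
  show "subcategory St (stable_sub C P X)"
    unfolding subcategory_def
  proof (intro conjI ballI impI)
    show "Obj (stable_sub C P X) \<subseteq> Obj St" using XC by simp
    show "stable_sub C P X = full_on St (Obj (stable_sub C P X))" by (simp add: stable_sub_def)
    fix A B assume "A \<in> Obj (stable_sub C P X)" "B \<in> Obj St" "isomorphic St A B"
    then obtain F G where "A \<in> Obj X" "mor St A B F" "mor St B A G" "F \<cdot>\<^bsub>St\<^esub> G = Ident St B"
      using XC unfolding isomorphic_def mor_def by auto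
    then show "B \<in> Obj (stable_sub C P X)" using retract by simp
  qed
  fix A assume A: "A \<in> Obj St"
  obtain X0 j where j: "is_preenvelope C (Obj X) A X0 j" using env A by (auto simp: preenveloping_def)
  \<comment> \<open>As \<open>X\<close> contains \<open>P\<close>, the preenvelope \<open>j\<close>
    is also a \<open>P\<close>-monomorphism, which makes its cokernel a stable weak
    cokernel.\<close>
  then have X0: "X0 \<in> Obj X" and mj: "mor C A X0 j" and "rel_mono C (Obj P) A X0 j"
    using PX by (auto simp: is_preenvelope_def rel_mono_def mor_def)
  moreover obtain Q c where c: "is_cokernel C A X0 j Q c"
    using cokernel_exists mj unfolding mor_def by blast
  ultimately have wc: "is_weak_cokernel St A X0 (cls A X0 j) Q (cls X0 Q c)"
    using weak_cokernel_stable by blast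
  have mc: "mor C X0 Q c" using c by (simp add: is_cokernel_def mor_def)
  obtain X1 l where l: "is_preenvelope C (Obj X) Q X1 l"
    using env morD(2)[OF mc] by (auto simp: preenveloping_def)
  then have X1: "X1 \<in> Obj X" and ml: "mor C Q X1 l" by (auto simp: is_preenvelope_iff)
  obtain K k where K: "K \<in> Obj X" and "is_weak_kernel St X0 X1 (cls X0 X1 (l \<cdot> c)) K k"
    using weak_kernel_in_resolving[OF X X0 X1 mor_comp[OF mc ml]] .
  then have wk: "is_weak_kernel St X0 X1 (cls Q X1 l \<cdot>\<^bsub>St\<^esub> cls X0 Q c) K k"
    using cls_comp[OF mc ml] by simp
  show "\<exists>B \<eta>. is_reflection St (Obj (stable_sub C P X)) A B \<eta>"
    using stable.reflection_exists[OF split _ retract is_preenvelope_stable[OF j XC] wc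
        is_preenvelope_stable[OF l XC] wk K] XC by simp
qed

text \<open>The chosen precover of an object of \<open>X\<close> is itself a
  \<open>P\<close>-epimorphism between objects of \<open>X\<close>.\<close>

lemma loop_closed_resolving:
  assumes X: "weakly_resolving C P X"
  shows "FObj (loop_functor C P) ` Obj X \<subseteq> Obj X"
proof
  fix K assume "K \<in> FObj (loop_functor C P) ` Obj X"
  then obtain A where A: "A \<in> Obj X" "K = FObj (loop_functor C P) A" by blast
  have PX: "Obj P \<subseteq> Obj X" and "Obj X \<subseteq> Obj C"
    using X subcategoryD(1) by (auto simp: weakly_resolving_def additive_subcategory_def)
  then obtain Q p \<kappa> where p: "is_precover C (Obj P) A Q p" "is_kernel C Q A p K \<kappa>"
    using loop_choice_exists A by blast
  then have "Q \<in> Obj X" "rel_epi C (Obj P) Q A p" using PX by (auto simp: is_precover_def)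
  then show "K \<in> Obj X" using X A(1) p(2) unfolding weakly_resolving_def by blast
qed

section \<open>From reflective subcategories back to resolving ones\<close>

context
  fixes Y
  assumes refl: "reflective St Y" and loop: "FObj (loop_functor C P) ` Obj Y \<subseteq> Obj Y"
begin

lemma reflective_subcategory: "subcategory St Y"
  using refl by (simp add: reflective_def)

lemma reflective_Obj: "Obj Y \<subseteq> Obj C"
  using subcategoryD(1)[OF reflective_subcategory] by simp

lemma reflective_biproduct_closed:
  "\<lbrakk>A \<in> Obj Y; B \<in> Obj Y; is_biproduct C A B S\<rbrakk> \<Longrightarrow> S \<in> Obj Y"
  using stable.reflective_biproduct[OF refl _ _ is_biproduct_stable] .

text \<open>The identity of an object of \<open>P\<close> factors through that object, so the object
  is stably zero.\<close>

lemma reflective_contains_P: "Obj P \<subseteq> Obj Y"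
proof
  fix Q assume Q: "Q \<in> Obj P"
  then have "Q \<in> Obj C" by (rule P_Obj)
  moreover have "Ident C Q \<in> factoring C P Q Q"
    using factoringI[OF Q mor_ident mor_ident] id_left[OF mor_ident] P_Obj[OF Q] by simp
  ultimately show "Q \<in> Obj Y"
    using stable.reflective_zero[OF refl] cls_eq_zero_iff[OF mor_ident] by simp
qed

lemma additive_subcategory_of_reflective: "additive_subcategory C (full_on C (Obj Y))"
proof -
  have sub: "subcategory C (full_on C (Obj Y))"
    unfolding subcategory_def full_on_simps
  proof (intro conjI ballI impI)
    fix A B assume "A \<in> Obj Y" "B \<in> Obj C" "isomorphic C A B"
    then show "B \<in> Obj Y"
      using subcategoryD(5)[OF reflective_subcategory, of A B] isomorphic_stable[of A B]
        subsetD[OF reflective_Obj, of A] by simp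
  qed (use reflective_Obj in simp_all)
  obtain Z where Z: "is_zero_object C Z" using zero_object_exists by blast
  then have ZC: "Z \<in> Obj C" by (simp add: is_zero_object_def)
  then have "Ident C Z = zero_mor C Z Z"
    using Z mor_ident mor_zero unfolding is_zero_object_def mor_def by blast
  then have "Z \<in> Obj Y" using stable.reflective_zero[OF refl] cls_zero ZC by simp
  then show ?thesis
    using additive_subcategory_full_onI[OF _ sub Z] reflective_biproduct_closed additive_category_axioms
    by blast
qed

lemma weakly_resolving_of_reflective: "weakly_resolving C P (full_on C (Obj Y))"
proof -
  have "K \<in> Obj Y"
    if A: "A \<in> Obj Y" and B: "B \<in> Obj Y" and f: "rel_epi C (Obj P) A B f" and k: "is_kernel C A B f K k"
    for A B f K k
  proof -
    obtain Q p \<kappa> where p: "is_precover C (Obj P) B Q p"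
      and \<kappa>: "is_kernel C Q B p (FObj (loop_functor C P) B) \<kappa>"
      using loop_choice_exists B reflective_Obj by blast
    obtain \<delta> where "is_weak_kernel St K A (cls K A k) (FObj (loop_functor C P) B) \<delta>"
      using loop_weak_kernel[OF f k p \<kappa>] by blast
    then show ?thesis
      using stable.reflective_weak_kernel[OF refl A B weak_kernel_stable[OF f k]] loop B by blast
  qed
  then show ?thesis
    unfolding weakly_resolving_def full_on_simps
    using additive_subcategory_of_reflective reflective_contains_P
      precovering_P[unfolded precovering_def] subsetD[OF reflective_Obj]
    by (intro conjI) blast+
qed

lemma closed_under_summands_of_reflective: "closed_under_summands C (full_on C (Obj Y))"
proof -
  have "A \<in> Obj Y" if S: "S \<in> Obj Y" and bip: "is_biproduct C A B S" for A B S
  proof -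
    obtain i p where "mor St A S i" "mor St S A p" "p \<cdot>\<^bsub>St\<^esub> i = Ident St A"
      using stable.is_biproductE[OF is_biproduct_stable[OF bip]] by metis
    then show ?thesis using stable.reflective_retract[OF refl S] by blast
  qed
  then show ?thesis by (auto simp: closed_under_summands_def)
qed

text \<open>The reflection of \<open>A\<close> is an \<open>X\<close>-preenvelope up to morphisms factoring through \<open>P\<close>; these
  are taken care of by a \<open>P\<close>-preenvelope of \<open>A\<close>.\<close>

lemma preenveloping_of_reflective: "preenveloping C (full_on C (Obj Y))"
proof -
  have "\<exists>S j. is_preenvelope C (Obj Y) A S j" if A: "A \<in> Obj C" for A
  proof -
    obtain B \<eta>' where \<eta>': "is_reflection St (Obj Y) A B \<eta>'" using stable.reflectiveD[OF refl, of A] A by (simp only: stable_simps) blast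
    then have B: "B \<in> Obj Y" and "mor St A B \<eta>'" by (auto simp: is_reflection_def)
    then obtain \<eta> where \<eta>: "mor C A B \<eta>" "\<eta>' = cls A B \<eta>" using stable_mor_iff by blast
    obtain Q e where e: "is_preenvelope C (Obj P) A Q e"
      using preenveloping_P A unfolding preenveloping_def by blast
    then have Q: "Q \<in> Obj P" and me: "mor C A Q e" by (auto simp: is_preenvelope_iff)
    obtain S where S: "S \<in> Obj Y" "is_biproduct C B Q S"
      using additive_subcategory_biproduct[OF additive_subcategory_of_reflective, of B Q]
        B subsetD[OF reflective_contains_P Q] unfolding full_on_simps by blast
    obtain i j p q where i: "mor C B S i" and j: "mor C Q S j" and p: "mor C S B p" and q: "mor C S Q q"
      and eq: "p \<cdot> i = Ident C B" "q \<cdot> j = Ident C Q" "q \<cdot> i = zero_mor C B Q" "p \<cdot> j = zero_mor C Q B"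
      using is_biproductE[OF S(2)] by metis
    note i\<eta> = mor_comp[OF \<eta>(1) i] and je = mor_comp[OF me j]
    \<comment> \<open>The column of \<open>\<eta>\<close> and \<open>e\<close>. The first component
      extends morphisms up to an error through \<open>P\<close>, the second gives access to that
      error.\<close>
    let ?a = "i \<cdot> \<eta> \<otimes>\<^bsub>HomGrp C A S\<^esub> (j \<cdot> e)"
    have a: "mor C A S ?a" by (rule mor_add[OF i\<eta> je])
    have pa: "p \<cdot> ?a = \<eta>"
      using comp_add[OF i\<eta> je p] assoc[OF \<eta>(1) i p] assoc[OF me j p] eq id_left[OF \<eta>(1)]
        zero_comp[OF me morD(2)[OF \<eta>(1)]] add_zero[OF \<eta>(1)] by simp
    have qa: "q \<cdot> ?a = e"
      using comp_add[OF i\<eta> je q] assoc[OF \<eta>(1) i q] assoc[OF me j q] eq id_left[OF me]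
        zero_comp[OF \<eta>(1) morD(2)[OF me]] zero_add[OF me] by simp
    have "\<exists>g. mor C S T g \<and> g \<cdot> ?a = t" if T: "T \<in> Obj Y" and t: "mor C A T t" for T t
    proof -
      obtain G where G: "mor St B T G" "G \<cdot>\<^bsub>St\<^esub> \<eta>' = cls A T t"
        using \<eta>' T mor_cls[OF t] unfolding is_reflection_def by blast
      then obtain g where g: "mor C B T g" "G = cls B T g" using stable_mor_iff by blast
      have "cls A T t = cls A T (g \<cdot> \<eta>)" using G(2) g(2) \<eta>(2) cls_comp[OF \<eta>(1) g(1)] by simp
      then obtain h where h: "h \<in> factoring C P A T" "t = h \<otimes>\<^bsub>HomGrp C A T\<^esub> (g \<cdot> \<eta>)"
        using cls_eq_iff[OF t mor_comp[OF \<eta>(1) g(1)]] by blast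
      obtain R u v where R: "R \<in> Obj P" and u: "mor C A R u" and v: "mor C R T v" and hv: "h = v \<cdot> u"
        using factoringE[OF h(1) morD(1,2)[OF t]] .
      \<comment> \<open>The error factors through \<open>R\<close> in \<open>P\<close>, so its first
        factor extends over the \<open>P\<close>-preenvelope \<open>e\<close>. Hence
        \<open>?g\<close> below has \<open>v \<cdot> w\<close> on the summand \<open>Q\<close> and
        \<open>g\<close> on the summand \<open>B\<close>.\<close>
      obtain w where w: "mor C Q R w" "w \<cdot> e = u"
        using e R u morD(2)[OF me] unfolding is_preenvelope_iff mor_def by blast
      note vw = mor_comp[OF w(1) v]
      let ?g = "v \<cdot> w \<cdot> q \<otimes>\<^bsub>HomGrp C S T\<^esub> (g \<cdot> p)"
      have "?g \<cdot> ?a = t"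
        using add_comp[OF a mor_comp[OF q vw] mor_comp[OF p g(1)]] assoc[OF a q vw] assoc[OF a p g(1)]
          pa qa assoc[OF me w(1) v] w(2) hv h(2) by simp
      then show ?thesis using mor_add[OF mor_comp[OF q vw] mor_comp[OF p g(1)]] by blast
    qed
    then have "is_preenvelope C (Obj Y) A S ?a"
      unfolding is_preenvelope_iff using S(1) a mor_comp[OF a] reflective_Obj A
      by (auto simp: mor_def subset_iff)
    then show ?thesis by blast
  qed
  then show ?thesis by (simp add: preenveloping_def)
qed

end

text \<open>The inverse takes the full subcategory of \<open>C\<close> on the same objects. Equality
  after a round trip only uses that full subcategories are determined by their objects.\<close>

theorem stable_sub_bij:
  assumes "split_idempotents St"
  shows "bij_betw (stable_sub C P)
       {X. weakly_resolving C P X \<and> preenveloping C X \<and> closed_under_summands C X}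
       {Y. reflective St Y \<and> FObj (loop_functor C P) ` Obj Y \<subseteq> Obj Y}"
proof (rule bij_betwI[where g = "\<lambda>Y. full_on C (Obj Y)"])
  show "stable_sub C P \<in> {X. weakly_resolving C P X \<and> preenveloping C X \<and> closed_under_summands C X} \<rightarrow>
      {Y. reflective St Y \<and> FObj (loop_functor C P) ` Obj Y \<subseteq> Obj Y}"
    using reflective_stable_sub[OF assms] loop_closed_resolving by (auto simp: image_subset_iff)
  show "(\<lambda>Y. full_on C (Obj Y)) \<in> {Y. reflective St Y \<and> FObj (loop_functor C P) ` Obj Y \<subseteq> Obj Y} \<rightarrow>
      {X. weakly_resolving C P X \<and> preenveloping C X \<and> closed_under_summands C X}"
    using weakly_resolving_of_reflective closed_under_summands_of_reflective preenveloping_of_reflective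
    by blast
next
  fix X assume "X \<in> {X. weakly_resolving C P X \<and> preenveloping C X \<and> closed_under_summands C X}"
  then have "subcategory C X" by (simp add: weakly_resolving_def additive_subcategory_def)
  then show "full_on C (Obj (stable_sub C P X)) = X"
    unfolding Obj_stable_sub by (rule full_on_subcategory[symmetric])
next
  fix Y assume "Y \<in> {Y. reflective St Y \<and> FObj (loop_functor C P) ` Obj Y \<subseteq> Obj Y}"
  then have "subcategory St Y" by (simp add: reflective_def)
  then show "stable_sub C P (full_on C (Obj Y)) = Y"
    unfolding stable_sub_def full_on_simps by (rule full_on_subcategory[symmetric])
qed

end

lemma bij_betw_opp: "bij_betw opp {X. \<Phi> (opp X)} {X. \<Phi> X}"
  by (rule bij_betwI[where g = opp]) auto

theorem corollary5p6:
  fixes C P :: "('o, 'm) cat"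
  assumes "abelian_category C"
    and "additive_subcategory C P"
    and "precovering C P"
    and "preenveloping C P"
    and "split_idempotents (stable C P)"
  shows
    "bij_betw (stable_sub C P)
       {X. weakly_resolving C P X \<and> preenveloping C X \<and> closed_under_summands C X}
       {Y. reflective (stable C P) Y \<and> FObj (loop_functor C P) ` Obj Y \<subseteq> Obj Y}
     \<and>
     bij_betw (stable_sub C P)
       {X. weakly_coresolving C P X \<and> precovering C X \<and> closed_under_summands C X}
       {Y. coreflective (stable C P) Y \<and> FObj (suspension_functor C P) ` Obj Y \<subseteq> Obj Y}"
proof
  interpret abelian_category C by fact
  interpret abelian_stable_category C P using assms by unfold_locales
  show "bij_betw (stable_sub C P)
       {X. weakly_resolving C P X \<and> preenveloping C X \<and> closed_under_summands C X}
       {Y. reflective (stable C P) Y \<and> FObj (loop_functor C P) ` Obj Y \<subseteq> Obj Y}"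
    by (rule stable_sub_bij) fact
  interpret opp: abelian_category "opp C" by (rule abelian_category_opp) fact
  interpret opp: abelian_stable_category "opp C" "opp P"
    using assms by unfold_locales
      (simp_all add: additive_subcategory_opp precovering_opp preenveloping_opp)
  let ?X = "\<lambda>X. weakly_resolving (opp C) (opp P) X \<and> preenveloping (opp C) X \<and> closed_under_summands (opp C) X"
  let ?Y = "\<lambda>Y. reflective (opp St) Y \<and> FObj (suspension_functor C P) ` Obj Y \<subseteq> Obj Y"
  have sub: "bij_betw (stable_sub (opp C) (opp P)) {X. ?X X} {Y. ?Y Y}"
    using opp.stable_sub_bij split_idempotents_opp[OF assms(5)] by (simp add: stable_opp FObj_loop_opp)
  have X: "bij_betw opp {X. ?X (opp X)} {X. ?X X}" by (rule bij_betw_opp)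
  have Y: "bij_betw opp {Y. ?Y Y} {Y. ?Y (opp Y)}"
    using bij_betw_opp[of "\<lambda>Y. ?Y (opp Y)"] by (simp only: opp_opp)
  \<comment> \<open>The bijection for the opposite category is conjugated by \<open>opp\<close>; the
    conjugate is \<open>stable_sub C P\<close>, and the duality lemmas identify source and target
    with the coresolving and coreflective classes.\<close>
  have "bij_betw (opp \<circ> (stable_sub (opp C) (opp P) \<circ> opp)) {X. ?X (opp X)} {Y. ?Y (opp Y)}"
    by (rule bij_betw_trans[OF bij_betw_trans[OF X sub] Y])
  moreover have "opp \<circ> (stable_sub (opp C) (opp P) \<circ> opp) = stable_sub C P"
    by (simp add: fun_eq_iff stable_sub_opp)
  ultimately show "bij_betw (stable_sub C P)
       {X. weakly_coresolving C P X \<and> precovering C X \<and> closed_under_summands C X}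
       {Y. coreflective (stable C P) Y \<and> FObj (suspension_functor C P) ` Obj Y \<subseteq> Obj Y}"
    unfolding weakly_resolving_opp preenveloping_opp closed_under_summands_opp opp_simps
      coreflective_iff[OF preadditive_stable] by (simp only:)
qed

end
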